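(* Let $q\in\Omega$ and $\mathbf{Q}_{-q}\in\mathscr{Q}_{-q}$. Let $c_q(\mathbf{Q}_{-q})\triangleq P_q+\max_{i\in\{1,\ldots,r_q\}}[\mathbf{D}_q(\mathbf{Q}_{-q})]_{ii}^{-1}$. Then for every constant $c_q\ge c_q(\mathbf{Q}_{-q})$ the MIMO waterfilling operator can be written as $$\mathbf{WF}_q(\mathbf{Q}_{-q})=\Big[-\Big(\big(\mathbf{H}_{qq}^H\mathbf{R}_{-q}^{-1}(\mathbf{Q}_{-q})\mathbf{H}_{qq}\big)^{\sharp}+c_q\,\mathbf{P}_{\mathcal{N}(\mathbf{H}_{qq})}\Big)\Big]_{\mathscr{Q}_q}.$$ Moreover, an upper bound of $c_q(\mathbf{Q}_{-q})$ independent of $\mathbf{Q}_{-q}$ is $$c_q(\mathbf{Q}_{-q})<P_q+\frac{\rho(\mathbf{R}_{n_q})+Q\,P_{\max}\max_{r\in\Omega}\rho(\mathbf{H}_{rq}^H\mathbf{H}_{rq})}{\lambda_{\min}^{+}(\mathbf{H}_{qq}^H\mathbf{H}_{qq})}<\infty ,$$ where $P_{\max}\triangleq\max_{q}P_q$ and $\lambda_{\min}^{+}(\cdot)$ denotes the smallest positive eigenvalue.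
   Context: Setting. $\Omega=\{1,\ldots,Q\}$. For $r,q\in\Omega$, $\mathbf{H}_{rq}\in\mathbb{C}^{n_{R_q}\times n_{T_r}}$ are arbitrary matrices with $\mathbf{H}_{qq}\ne\mathbf{0}$, $\mathbf{R}_{n_q}\in\mathbb{C}^{n_{R_q}\times n_{R_q}}$ is Hermitian positive definite, and $P_q>0$. The strategy sets are $\mathscr{Q}_q=\{\mathbf{Q}\in\mathbb{C}^{n_{T_q}\times n_{T_q}}:\mathbf{Q}\succeq\mathbf{0},\ \mathrm{Tr}(\mathbf{Q})=P_q\}$ (positive semidefinite matrices are Hermitian), $\mathscr{Q}_{-q}=\prod_{r\ne q}\mathscr{Q}_r$, and for $\mathbf{Q}_{-q}=(\mathbf{Q}_r)_{r\neq q}\in\mathscr{Q}_{-q}$, $$\mathbf{R}_{-q}(\mathbf{Q}_{-q})=\mathbf{R}_{n_q}+\sum_{r\neq q}\mathbf{H}_{rq}\mathbf{Q}_r\mathbf{H}_{rq}^H .$$ Waterfilling operator. Write the reduced eigendecomposition $\mathbf{H}_{qq}^H\mathbf{R}_{-q}^{-1}(\mathbf{Q}_{-q})\mathbf{H}_{qq}=\mathbf{U}_q\mathbf{D}_q\mathbf{U}_q^H$, with $\mathbf{U}_q=\mathbf{U}_q(\mathbf{Q}_{-q})\in\mathbb{C}^{n_{T_q}\times r_q}$ having orthonormal columns, $\mathbf{D}_q=\mathbf{D}_q(\mathbf{Q}_{-q})$ an $r_q\times r_q$ diagonal matrix with positive diagonal entries, and $r_q=\mathrm{rank}(\mathbf{H}_{qq})$.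 Then $$\mathbf{WF}_q(\mathbf{Q}_{-q})=\mathbf{U}_q(\mu_q\mathbf{I}-\mathbf{D}_q^{-1})^+\mathbf{U}_q^H,$$ where $(\cdot)^+=\max(0,\cdot)$ acts on the diagonal entries and $\mu_q$ is chosen so that $\mathrm{Tr}\{(\mu_q\mathbf{I}-\mathbf{D}_q^{-1})^+\}=P_q$. Notation. $(\cdot)^\sharp$ is the Moore-Penrose pseudoinverse; $\rho(\cdot)$ the spectral radius; $\mathbf{P}_{\mathcal{N}(\mathbf{H}_{qq})}$ the orthogonal projection matrix onto the null space of $\mathbf{H}_{qq}$; $[\mathbf{X}]_{\mathscr{Q}_q}=\operatorname{argmin}_{\mathbf{Z}\in\mathscr{Q}_q}\|\mathbf{Z}-\mathbf{X}\|_F$ the projection in Frobenius norm. *)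

theory Defs
  imports
    "Jordan_Normal_Form.Schur_Decomposition"
    "Jordan_Normal_Form.Gauss_Jordan_Elimination"
    "Jordan_Normal_Form.DL_Rank"
    "Jordan_Normal_Form.Matrix_Kernel"
    "Jordan_Normal_Form.Spectral_Radius"
    "HOL-Library.Extended_Real"
    "HOL-Library.FuncSet"
begin

definition mtrace :: "'a::comm_monoid_add mat \<Rightarrow> 'a" where
  "mtrace A = (\<Sum>i<dim_row A. A $$ (i, i))"

definition frob_norm :: "complex mat \<Rightarrow> real" where
  "frob_norm A = sqrt (\<Sum>i<dim_row A. \<Sum>j<dim_col A. (cmod (A $$ (i, j)))\<^sup>2)"

definition minv :: "complex mat \<Rightarrow> complex mat" where
  "minv A = the (mat_inverse A)"

text \<open>As \<^term>\<open>v \<bullet>c w\<close> conjugates its second argument, \<^term>\<open>(A *\<^sub>v v) \<bullet>c v\<close>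
  is the quadratic form $v^H A v$; for Hermitian matrices it is real.\<close>

definition hermitian_mat :: "nat \<Rightarrow> complex mat \<Rightarrow> bool" where
  "hermitian_mat n A \<longleftrightarrow> A \<in> carrier_mat n n \<and> mat_adjoint A = A"

definition psd_mat :: "nat \<Rightarrow> complex mat \<Rightarrow> bool" where
  "psd_mat n A \<longleftrightarrow>
     hermitian_mat n A \<and> (\<forall>v \<in> carrier_vec n. 0 \<le> Re ((A *\<^sub>v v) \<bullet>c v))"

definition pd_mat :: "nat \<Rightarrow> complex mat \<Rightarrow> bool" where
  "pd_mat n A \<longleftrightarrow>
     hermitian_mat n A \<and> (\<forall>v \<in> carrier_vec n. v \<noteq> 0\<^sub>v n \<longrightarrow> 0 < Re ((A *\<^sub>v v) \<bullet>c v))"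

text \<open>The four Penrose conditions.\<close>

definition is_pseudoinverse :: "complex mat \<Rightarrow> complex mat \<Rightarrow> bool" where
  "is_pseudoinverse A X \<longleftrightarrow>
     X \<in> carrier_mat (dim_col A) (dim_row A) \<and>
     A * X * A = A \<and> X * A * X = X \<and>
     mat_adjoint (A * X) = A * X \<and> mat_adjoint (X * A) = X * A"

definition pseudoinverse :: "complex mat \<Rightarrow> complex mat" where
  "pseudoinverse A = (THE X. is_pseudoinverse A X)"

definition is_orth_proj :: "nat \<Rightarrow> complex vec set \<Rightarrow> complex mat \<Rightarrow> bool" where
  "is_orth_proj n W X \<longleftrightarrow>
     X \<in> carrier_mat n n \<and>
     (\<forall>v \<in> carrier_vec n. X *\<^sub>v v \<in> W \<and> (\<forall>w \<in> W. (v - X *\<^sub>v v) \<bullet>c w = 0))"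

definition null_proj :: "complex mat \<Rightarrow> complex mat" where
  "null_proj A = (THE X. is_orth_proj (dim_col A) (mat_kernel A) X)"

definition min_pos_eigenvalue :: "complex mat \<Rightarrow> real" where
  "min_pos_eigenvalue A = Min {x. 0 < x \<and> eigenvalue A (complex_of_real x)}"

definition strategy_set :: "nat \<Rightarrow> real \<Rightarrow> complex mat set" where
  "strategy_set n p = {Z. psd_mat n Z \<and> mtrace Z = complex_of_real p}"

definition strategy_proj :: "nat \<Rightarrow> real \<Rightarrow> complex mat \<Rightarrow> complex mat" where
  "strategy_proj n p X = arg_min_on (\<lambda>Z. frob_norm (Z - X)) (strategy_set n p)"

text \<open>The argument \<^term>\<open>H r q\<close> is the channel from transmitter \<^term>\<open>r\<close> to receiver
  \<^term>\<open>q\<close>. The sum over the interferers is taken entrywise, because matrices of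
  unspecified dimension do not form a monoid under addition.\<close>

definition intf_cov ::
  "nat \<Rightarrow> (nat \<Rightarrow> nat \<Rightarrow> complex mat) \<Rightarrow> (nat \<Rightarrow> complex mat) \<Rightarrow> nat \<Rightarrow> (nat \<Rightarrow> complex mat) \<Rightarrow> complex mat"
  where
  "intf_cov Q H Rn q Qs = Rn q +
     mat (dim_row (Rn q)) (dim_col (Rn q))
       (\<lambda>ij. \<Sum>r \<in> {1..Q} - {q}. (H r q * Qs r * mat_adjoint (H r q)) $$ ij)"

definition eff_gram ::
  "nat \<Rightarrow> (nat \<Rightarrow> nat \<Rightarrow> complex mat) \<Rightarrow> (nat \<Rightarrow> complex mat) \<Rightarrow> nat \<Rightarrow> (nat \<Rightarrow> complex mat) \<Rightarrow> complex mat"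
  where
  "eff_gram Q H Rn q Qs = mat_adjoint (H q q) * minv (intf_cov Q H Rn q Qs) * H q q"

definition reduced_eigendecomp ::
  "complex mat \<Rightarrow> nat \<Rightarrow> complex mat \<Rightarrow> real mat \<Rightarrow> bool" where
  "reduced_eigendecomp A r U D \<longleftrightarrow>
     U \<in> carrier_mat (dim_row A) r \<and> mat_adjoint U * U = 1\<^sub>m r \<and>
     D \<in> carrier_mat r r \<and> diagonal_mat D \<and> (\<forall>i<r. 0 < D $$ (i, i)) \<and>
     A = U * map_mat complex_of_real D * mat_adjoint U"

text \<open>The matrix $(\mu I - D^{-1})^+$ for a diagonal matrix $D$ with positive diagonal.\<close>

definition wf_levels :: "real \<Rightarrow> real mat \<Rightarrow> real mat" where
  "wf_levels \<mu> D = mat_diag (dim_row D) (\<lambda>i. max 0 (\<mu> - 1 / D $$ (i, i)))"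

definition is_waterfilling :: "complex mat \<Rightarrow> nat \<Rightarrow> real \<Rightarrow> complex mat \<Rightarrow> bool" where
  "is_waterfilling A r p W \<longleftrightarrow>
     (\<exists>U D \<mu>. reduced_eigendecomp A r U D \<and> mtrace (wf_levels \<mu> D) = p \<and>
        W = U * map_mat complex_of_real (wf_levels \<mu> D) * mat_adjoint U)"

definition direct_rank :: "(nat \<Rightarrow> nat \<Rightarrow> complex mat) \<Rightarrow> nat \<Rightarrow> nat" where
  "direct_rank H q = vec_space.rank (dim_row (H q q)) (H q q)"

text \<open>A reduced eigendecomposition is not unique. The definite descriptions below express
  that the results do not depend on which one is used.\<close>

definition WF ::
  "nat \<Rightarrow> (nat \<Rightarrow> nat \<Rightarrow> complex mat) \<Rightarrow> (nat \<Rightarrow> complex mat) \<Rightarrow> (nat \<Rightarrow> real) \<Rightarrow> nat \<Rightarrow> (nat \<Rightarrow> complex mat) \<Rightarrow> complex mat"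
  where
  "WF Q H Rn P q Qs =
     (THE W. is_waterfilling (eff_gram Q H Rn q Qs) (direct_rank H q) (P q) W)"

definition c_min ::
  "nat \<Rightarrow> (nat \<Rightarrow> nat \<Rightarrow> complex mat) \<Rightarrow> (nat \<Rightarrow> complex mat) \<Rightarrow> (nat \<Rightarrow> real) \<Rightarrow> nat \<Rightarrow> (nat \<Rightarrow> complex mat) \<Rightarrow> real"
  where
  "c_min Q H Rn P q Qs =
     (THE c. \<exists>U D. reduced_eigendecomp (eff_gram Q H Rn q Qs) (direct_rank H q) U D \<and>
        c = P q + Max ((\<lambda>i. 1 / D $$ (i, i)) ` {..<direct_rank H q}))"

end

theory Submission
  imports Defs
begin

text \<open>
  In a reduced eigendecomposition \<open>A = U D U\<^sup>H\<close>, the pseudoinverse of \<open>A\<close> is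
  \<open>U D\<^sup>-\<^sup>1 U\<^sup>H\<close> and the projection onto the common kernel of \<open>A\<close> and \<open>H\<close> is
  \<open>C = I - U U\<^sup>H\<close>. Adding the waterfilling matrix \<open>W\<close> to
  \<open>A\<^sup>\<sharp> + c C\<close> lifts the levels \<open>1 / d\<^sub>i < \<mu>\<close> to \<open>\<mu>\<close> and keeps the others, so the sum is
  \<open>\<mu> I + M\<close> with \<open>M\<close> positive semidefinite (here \<open>\<mu> \<le> c\<close> is needed) and \<open>M W = 0\<close>. This is
  the variational inequality of the projection. Its solution does not mention \<open>U\<close> and \<open>D\<close>, which
  shows at the same time that \<open>W\<close> does not depend on the chosen decomposition.

  For the bound, \<open>R \<le> s I\<close> gives \<open>R\<^sup>-\<^sup>1 \<ge> I / s\<close>, so an eigenvalue of \<open>H\<^sup>H R\<^sup>-\<^sup>1 H\<close> whose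
  eigenvector is orthogonal to the kernel of \<open>H\<close> is at least \<open>\<lambda> / s\<close>, where \<open>\<lambda>\<close> is the least
  positive eigenvalue of \<open>H\<^sup>H H\<close>. Since only \<open>Q - 1\<close> users interfere, \<open>s\<close> can be taken
  strictly below the numerator of the claim.
\<close>

subsection \<open>Adjoints, inner products and traces\<close>

lemma mat_adjoint_dim [simp]:
  "dim_row (mat_adjoint A) = dim_col A" "dim_col (mat_adjoint A) = dim_row A"
  by (auto simp: mat_adjoint_def)

lemma mat_adjoint_carrier [simp, intro]:
  "A \<in> carrier_mat m n \<Longrightarrow> mat_adjoint A \<in> carrier_mat n m"
  by (auto intro: carrier_matI)

lemma mat_adjoint_index [simp]:
  fixes A :: "complex mat"
  assumes "i < dim_col A" "j < dim_row A"
  shows "mat_adjoint A $$ (i, j) = cnj (A $$ (j, i))"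
  using assms by (simp add: mat_adjoint_def mat_of_rows_index)

lemma mat_adjoint_adjoint [simp]: "mat_adjoint (mat_adjoint A) = (A :: complex mat)"
  by (rule eq_matI) auto

lemma mult_mat_index:
  assumes "A \<in> carrier_mat m n" "B \<in> carrier_mat n p" "i < m" "j < p"
  shows "(A * B) $$ (i, j) = (\<Sum>k<n. A $$ (i, k) * B $$ (k, j))"
  using assms by (auto simp: scalar_prod_def atLeast0LessThan)

lemma mat_adjoint_mult:
  fixes A B :: "complex mat"
  assumes "A \<in> carrier_mat m n" "B \<in> carrier_mat n p"
  shows "mat_adjoint (A * B) = mat_adjoint B * mat_adjoint A"
proof (rule eq_matI)
  fix i j assume
    "i < dim_row (mat_adjoint B * mat_adjoint A)" "j < dim_col (mat_adjoint B * mat_adjoint A)"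
  then have ij: "i < p" "j < m" using assms by auto
  have "mat_adjoint (A * B) $$ (i, j) = cnj (\<Sum>k<n. A $$ (j, k) * B $$ (k, i))"
    using ij assms mult_mat_index[OF assms ij(2,1)] by simp
  also have "\<dots> = (\<Sum>k<n. mat_adjoint B $$ (i, k) * mat_adjoint A $$ (k, j))"
    using ij assms by (auto intro!: sum.cong)
  also have "\<dots> = (mat_adjoint B * mat_adjoint A) $$ (i, j)"
    using mult_mat_index[of "mat_adjoint B" p n "mat_adjoint A" m] ij assms by simp
  finally show "mat_adjoint (A * B) $$ (i, j) = (mat_adjoint B * mat_adjoint A) $$ (i, j)" .
qed (use assms in auto)

lemma mat_adjoint_one [simp]: "mat_adjoint (1\<^sub>m n :: complex mat) = 1\<^sub>m n"
  by (rule eq_matI) auto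

lemma mat_adjoint_add:
  fixes A B :: "complex mat"
  assumes "A \<in> carrier_mat m n" "B \<in> carrier_mat m n"
  shows "mat_adjoint (A + B) = mat_adjoint A + mat_adjoint B"
  by (rule eq_matI) (use assms in auto)

lemma mat_adjoint_minus:
  fixes A B :: "complex mat"
  assumes "A \<in> carrier_mat m n" "B \<in> carrier_mat m n"
  shows "mat_adjoint (A - B) = mat_adjoint A - mat_adjoint B"
  by (rule eq_matI) (use assms in auto)

lemma mat_adjoint_smult_real:
  "mat_adjoint (complex_of_real c \<cdot>\<^sub>m A) = complex_of_real c \<cdot>\<^sub>m mat_adjoint A"
  by (rule eq_matI) auto

section \<open>Complex inner products, matrix action on vectors and quadratic forms\<close>

lemma cscalar_prod_sum:
  fixes v w :: "complex vec"
  shows "v \<bullet>c w = (\<Sum>i<dim_vec w. v $ i * cnj (w $ i))"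
  by (auto simp: scalar_prod_def atLeast0LessThan)

lemma cscalar_prod_cnj:
  fixes v w :: "complex vec"
  assumes "dim_vec v = dim_vec w"
  shows "cnj (v \<bullet>c w) = w \<bullet>c v"
  using assms by (simp add: cscalar_prod_sum mult.commute)

lemma mult_mat_vec_index:
  assumes "A \<in> carrier_mat m n" "v \<in> carrier_vec n" "i < m"
  shows "(A *\<^sub>v v) $ i = (\<Sum>k<n. A $$ (i, k) * v $ k)"
  using assms by (auto simp: scalar_prod_def atLeast0LessThan)

lemma mult_mat_unit_vec:
  fixes A :: "'a :: comm_ring_1 mat"
  assumes "A \<in> carrier_mat m n" "i < n"
  shows "A *\<^sub>v unit_vec n i = col A i"
proof (rule eq_vecI)
  fix j assume "j < dim_vec (col A i)"
  then have j: "j < m" using assms by simp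
  have "(A *\<^sub>v unit_vec n i) $ j = (\<Sum>k<n. A $$ (j, k) * unit_vec n i $ k)"
    using assms j by (intro mult_mat_vec_index) auto
  also have "\<dots> = (\<Sum>k<n. if k = i then A $$ (j, k) else 0)"
    using assms by (intro sum.cong) auto
  finally show "(A *\<^sub>v unit_vec n i) $ j = col A i $ j" using assms j by simp
qed (use assms in auto)

lemma eq_mat_vecI:
  fixes A B :: "'a :: comm_ring_1 mat"
  assumes "A \<in> carrier_mat m n" "B \<in> carrier_mat m n"
    and "\<And>v. v \<in> carrier_vec n \<Longrightarrow> A *\<^sub>v v = B *\<^sub>v v"
  shows "A = B"
proof (rule mat_col_eqI)
  fix i assume "i < dim_col B"
  then show "col A i = col B i"
    using assms mult_mat_unit_vec[of A m n i] mult_mat_unit_vec[of B m n i] by auto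
qed (use assms in auto)

lemma adjoint_cscalar_prod:
  fixes A :: "complex mat"
  assumes "A \<in> carrier_mat m n" "v \<in> carrier_vec n" "w \<in> carrier_vec m"
  shows "(A *\<^sub>v v) \<bullet>c w = v \<bullet>c (mat_adjoint A *\<^sub>v w)"
proof -
  have "(A *\<^sub>v v) \<bullet>c w = (\<Sum>i<m. \<Sum>k<n. A $$ (i, k) * v $ k * cnj (w $ i))"
    using assms mult_mat_vec_index[OF assms(1,2)]
      by (auto simp: cscalar_prod_sum sum_distrib_right simp del: index_mult_mat_vec)
  also have "\<dots> = (\<Sum>k<n. \<Sum>i<m. A $$ (i, k) * v $ k * cnj (w $ i))"
    by (rule sum.swap)
  also have "\<dots> = v \<bullet>c (mat_adjoint A *\<^sub>v w)"
    using assms mult_mat_vec_index[of "mat_adjoint A" n m w]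
    by (auto simp: cscalar_prod_sum sum_distrib_left mult_ac simp del: index_mult_mat_vec intro!: sum.cong)
  finally show ?thesis .
qed

text \<open>The squared Euclidean norm, real-valued so that order arguments stay within the reals;
  \<open>cscalar_prod_self\<close> links it to the complex inner product.\<close>

definition vnorm2 :: "complex vec \<Rightarrow> real" where
  "vnorm2 v = (\<Sum>i<dim_vec v. (cmod (v $ i))\<^sup>2)"

lemma cscalar_prod_self: "v \<bullet>c v = complex_of_real (vnorm2 v)"
  by (simp add: cscalar_prod_sum vnorm2_def complex_norm_square del: of_real_power)

lemma vnorm2_diff:
  assumes "x \<in> carrier_vec n" "y \<in> carrier_vec n"
  shows "complex_of_real (vnorm2 (x - y)) = x \<bullet>c x - y \<bullet>c x - (x \<bullet>c y - y \<bullet>c y)"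
  unfolding cscalar_prod_self[symmetric, of "x - y"]
  using assms by (simp add: cscalar_prod_sum algebra_simps sum_subtractf sum.distrib)

lemma vnorm2_nonneg [simp]: "0 \<le> vnorm2 v"
  by (simp add: vnorm2_def sum_nonneg)

lemma vnorm2_eq_0: "v \<in> carrier_vec n \<Longrightarrow> vnorm2 v = 0 \<longleftrightarrow> v = 0\<^sub>v n"
  by (metis conjugate_square_eq_0_vec cscalar_prod_self of_real_eq_0_iff)

lemma vnorm2_pos: "v \<in> carrier_vec n \<Longrightarrow> v \<noteq> 0\<^sub>v n \<Longrightarrow> 0 < vnorm2 v"
  using vnorm2_eq_0[of v n] vnorm2_nonneg[of v] by linarith

lemma vnorm2_smult: "vnorm2 (k \<cdot>\<^sub>v v) = (cmod k)\<^sup>2 * vnorm2 v"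
  by (simp add: vnorm2_def norm_mult power_mult_distrib sum_distrib_left)

lemma vnorm2_mult:
  assumes "A \<in> carrier_mat m n" "v \<in> carrier_vec n"
  shows "complex_of_real (vnorm2 (A *\<^sub>v v)) = ((mat_adjoint A * A) *\<^sub>v v) \<bullet>c v"
proof -
  have "((mat_adjoint A * A) *\<^sub>v v) \<bullet>c v = (mat_adjoint A *\<^sub>v (A *\<^sub>v v)) \<bullet>c v"
    using assms by (simp add: assoc_mult_mat_vec[of _ n m _ n])
  also have "\<dots> = (A *\<^sub>v v) \<bullet>c (A *\<^sub>v v)"
    using adjoint_cscalar_prod[of "mat_adjoint A" n m "A *\<^sub>v v" v] assms by simp
  finally show ?thesis by (simp add: cscalar_prod_self)
qed

text \<open>Moving the Hermitian \<open>A\<close> across the inner product turns the form into its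
  own conjugate.\<close>

lemma hermitian_form_real:
  assumes "hermitian_mat n A" "v \<in> carrier_vec n"
  shows "(A *\<^sub>v v) \<bullet>c v = complex_of_real (Re ((A *\<^sub>v v) \<bullet>c v))"
proof -
  have "cnj ((A *\<^sub>v v) \<bullet>c v) = v \<bullet>c (A *\<^sub>v v)"
    using assms by (intro cscalar_prod_cnj) (auto simp: hermitian_mat_def)
  also have "\<dots> = (A *\<^sub>v v) \<bullet>c v"
    using adjoint_cscalar_prod[of A n n v v] assms by (auto simp: hermitian_mat_def)
  finally show ?thesis by (metis Reals_cnj_iff of_real_Re)
qed

section \<open>Trace and Frobenius norm\<close>

lemma mtrace_add:
  "A \<in> carrier_mat n n \<Longrightarrow> B \<in> carrier_mat n n \<Longrightarrow> mtrace (A + B)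
    = mtrace A + mtrace (B :: 'a :: comm_monoid_add mat)"
  by (simp add: mtrace_def sum.distrib)

lemma mtrace_minus:
  "A \<in> carrier_mat n n \<Longrightarrow> B \<in> carrier_mat n n \<Longrightarrow> mtrace (A - B)
    = mtrace A - mtrace (B :: 'a :: ab_group_add mat)"
  by (simp add: mtrace_def sum_subtractf)

lemma mtrace_smult: "A \<in> carrier_mat n n \<Longrightarrow> mtrace (c \<cdot>\<^sub>m A)
  = c * mtrace (A :: 'a :: comm_ring_1 mat)"
  by (simp add: mtrace_def sum_distrib_left)

lemma mtrace_mult:
  assumes "A \<in> carrier_mat m n" "B \<in> carrier_mat n m"
  shows "mtrace (A * B) = (\<Sum>i<m. \<Sum>j<n. A $$ (i, j) * B $$ (j, i))"
  using assms mult_mat_index[OF assms] by (simp add: mtrace_def del: index_mult_mat(1))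

lemma mtrace_mult_comm:
  fixes A B :: "'a :: comm_ring_1 mat"
  assumes "A \<in> carrier_mat m n" "B \<in> carrier_mat n m"
  shows "mtrace (A * B) = mtrace (B * A)"
  unfolding mtrace_mult[OF assms] mtrace_mult[OF assms(2,1)]
  by (subst sum.swap) (simp add: mult.commute)

lemma frob_norm_sq:
  "(frob_norm A)\<^sup>2 = (\<Sum>i<dim_row A. \<Sum>j<dim_col A. (cmod (A $$ (i, j)))\<^sup>2)"
  by (simp add: frob_norm_def sum_nonneg)

lemma frob_norm_nonneg [simp]: "0 \<le> frob_norm A"
  by (simp add: frob_norm_def sum_nonneg)

lemma mtrace_mult_adjoint:
  "mtrace (A * mat_adjoint A) = complex_of_real ((frob_norm A)\<^sup>2)"
proof -
  have "mtrace (A * mat_adjoint A)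
    = (\<Sum>i<dim_row A. \<Sum>j<dim_col A. A $$ (i, j) * mat_adjoint A $$ (j, i))"
    by (rule mtrace_mult) auto
  also have "\<dots> = (\<Sum>i<dim_row A. \<Sum>j<dim_col A. complex_of_real ((cmod (A $$ (i, j)))\<^sup>2))"
    by (intro sum.cong refl) (simp add: complex_norm_square del: of_real_power)
  finally show ?thesis by (simp add: frob_norm_sq)
qed

lemma frob_norm_eq_0:
  assumes "A \<in> carrier_mat m n" "frob_norm A = 0"
  shows "A = 0\<^sub>m m n"
proof -
  have "(\<Sum>i<m. \<Sum>j<n. (cmod (A $$ (i, j)))\<^sup>2) = 0"
    using assms frob_norm_sq[of A] by simp
  then have "\<forall>i<m. \<forall>j<n. A $$ (i, j) = 0"
    by (subst (asm) sum_nonneg_eq_0_iff) (auto simp: sum_nonneg_eq_0_iff sum_nonneg)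
  then show ?thesis using assms by (intro eq_matI) auto
qed

text \<open>Law of cosines. As \<open>C\<close> is Hermitian, the cross term becomes the real part
  of a trace of a plain product, the form in which the variational inequality of the projection is
  tested.\<close>

lemma frob_norm_add_sq:
  assumes "B \<in> carrier_mat n n" "hermitian_mat n C"
  shows "(frob_norm (B + C))\<^sup>2 = (frob_norm B)\<^sup>2 + (frob_norm C)\<^sup>2 + 2 * Re (mtrace (B * C))"
proof -
  have C: "C \<in> carrier_mat n n" "mat_adjoint C = C" using assms by (auto simp: hermitian_mat_def)
  have cnj: "Re (B $$ (i, j) * cnj (C $$ (i, j))) = Re (B $$ (i, j) * C $$ (j, i))"
    if "i < n" "j < n" for i j
    using that C mat_adjoint_index[of j C i] by simp
  have *: "(cmod (a + b))\<^sup>2 = (cmod a)\<^sup>2 + (cmod b)\<^sup>2 + 2 * Re (a * cnj b)" for a b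
    unfolding cmod_power2 by (simp add: power2_eq_square algebra_simps)
  have "(frob_norm (B + C))\<^sup>2 = (\<Sum>i<n. \<Sum>j<n. (cmod (B $$ (i, j)))\<^sup>2 + (cmod (C $$ (i, j)))\<^sup>2
          + 2 * Re (B $$ (i, j) * C $$ (j, i)))"
    unfolding frob_norm_sq using assms(1) C(1)
      by (auto simp: * cnj[symmetric] simp del: times_complex.sel complex_cnj_mult intro!: sum.cong)
  also have "\<dots> = (frob_norm B)\<^sup>2 + (frob_norm C)\<^sup>2 + 2 * Re (mtrace (B * C))"
    unfolding mtrace_mult[OF assms(1) C(1)] frob_norm_sq Re_sum sum.distrib sum_distrib_left
    using assms(1) C(1) by simp
  finally show ?thesis .
qed

subsection \<open>Functional calculus of an isometry\<close>

lemma diag_mult_vec: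
  fixes f :: "nat \<Rightarrow> 'a :: comm_ring_1"
  assumes "y \<in> carrier_vec r"
  shows "mat_diag r f *\<^sub>v y = vec r (\<lambda>i. f i * y $ i)"
proof (rule eq_vecI)
  fix i assume "i < dim_vec (vec r (\<lambda>i. f i * y $ i))"
  then have i: "i < r" by simp
  have "(mat_diag r f *\<^sub>v y) $ i = (\<Sum>k<r. (if i = k then f k else 0) * y $ k)"
    using mult_mat_vec_index[of "mat_diag r f" r r y i] assms i by (simp add: mat_diag_def)
  also have "\<dots> = (\<Sum>k<r. if i = k then f k * y $ k else 0)" by (intro sum.cong) auto
  also have "\<dots> = f i * y $ i" using i by simp
  finally show "(mat_diag r f *\<^sub>v y) $ i = vec r (\<lambda>i. f i * y $ i) $ i" using i by simp
qed (use assms in \<open>simp add: mat_diag_def\<close>)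

text \<open>Orthonormal columns turn real functions on the indices into Hermitian matrices
  \<open>S f\<close>; sums, products, traces and quadratic forms of these reduce to pointwise
  operations. All matrices derived from one eigendecomposition are expressed through such
  \<open>S f\<close> and the complementary projection \<open>C\<close>.\<close>

locale isometry =
  fixes n r :: nat and U :: "complex mat"
  assumes U_carrier [simp]: "U \<in> carrier_mat n r"
    and U_isometry: "mat_adjoint U * U = 1\<^sub>m r"
begin

definition S :: "(nat \<Rightarrow> real) \<Rightarrow> complex mat" where
  "S f = U * mat_diag r (\<lambda>i. complex_of_real (f i)) * mat_adjoint U"

text \<open>Coefficients of the orthogonal projection of \<open>v\<close> onto the span of the
  columns of \<open>U\<close>; in these coordinates \<open>S f\<close> is pointwise multiplication
  by \<open>f\<close>.\<close>

definition coords :: "complex vec \<Rightarrow> complex vec" where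
  "coords v = mat_adjoint U *\<^sub>v v"

lemma adjoint_U_carrier [simp]: "mat_adjoint U \<in> carrier_mat r n" by simp

lemma U_dim [simp]: "dim_row U = n" "dim_col U = r"
  by (rule carrier_matD[OF U_carrier])+

lemma U_diag_carrier [simp]: "U * mat_diag r f \<in> carrier_mat n r"
  by (rule mult_carrier_mat[of _ n r]) auto

lemma S_carrier [simp]: "S f \<in> carrier_mat n n"
  unfolding S_def by (rule mult_carrier_mat[of _ n r]) auto

lemma S_dim [simp]: "dim_row (S f) = n" "dim_col (S f) = n"
  by (rule carrier_matD[OF S_carrier])+

lemma coords_carrier [simp]: "v \<in> carrier_vec n \<Longrightarrow> coords v \<in> carrier_vec r"
  by (simp add: coords_def mult_mat_vec_carrier[of _ r n])

lemma dim_coords [simp]: "dim_vec (coords v) = r"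
  by (simp add: coords_def)

lemma S_cong: "(\<And>i. i < r \<Longrightarrow> f i = g i) \<Longrightarrow> S f = S g"
proof -
  assume "\<And>i. i < r \<Longrightarrow> f i = g i"
  then have "mat_diag r (\<lambda>i. complex_of_real (f i)) = mat_diag r (\<lambda>i. complex_of_real (g i))"
    by (intro eq_matI) (auto simp: mat_diag_def)
  then show ?thesis by (simp add: S_def)
qed

lemma S_index: "a < n \<Longrightarrow> b < n \<Longrightarrow> S f $$ (a, b) = (\<Sum>i<r. f i * U $$ (a, i) * cnj (U $$ (b, i)))"
  unfolding S_def
  by (subst mult_mat_index[OF U_diag_carrier adjoint_U_carrier])
    (simp_all add: mat_diag_mult_right[OF U_carrier] mult_ac)

lemma S_add: "S f + S g = S (\<lambda>i. f i + g i)"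
  by (rule eq_matI) (simp_all add: S_index sum.distrib distrib_right)

lemma S_smult: "complex_of_real c \<cdot>\<^sub>m S f = S (\<lambda>i. c * f i)"
  by (rule eq_matI) (simp_all add: S_index sum_distrib_left mult.assoc)

lemma S_adjoint [simp]: "mat_adjoint (S f) = S f"
  by (rule eq_matI) (simp_all add: S_index mult_ac)

lemma S_hermitian: "hermitian_mat n (S f)"
  by (simp add: hermitian_mat_def)

lemma S_zero: "S (\<lambda>_. 0) = 0\<^sub>m n n"
  by (rule eq_matI) (auto simp: S_index)

lemma adjoint_U_U_vec: "y \<in> carrier_vec r \<Longrightarrow> mat_adjoint U *\<^sub>v (U *\<^sub>v y) = y"
  using U_isometry assoc_mult_mat_vec[of "mat_adjoint U" r n U r y] by simp

lemma S_vec: "v \<in> carrier_vec n \<Longrightarrow> S f *\<^sub>v v = U *\<^sub>v vec r (\<lambda>i. f i * coords v $ i)"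
proof -
  let ?F = "mat_diag r (\<lambda>i. complex_of_real (f i))"
  assume v: "v \<in> carrier_vec n"
  have "S f *\<^sub>v v = U * ?F *\<^sub>v (mat_adjoint U *\<^sub>v v)"
    unfolding S_def using v
      by (intro assoc_mult_mat_vec[of _ n r _ n]) (auto intro: mult_carrier_mat[of _ n r])
  also have "\<dots> = U *\<^sub>v (?F *\<^sub>v coords v)"
    unfolding coords_def[symmetric] using v by (intro assoc_mult_mat_vec[of _ n r _ r]) auto
  finally show ?thesis using v by (simp add: diag_mult_vec)
qed

lemma coords_S: "v \<in> carrier_vec n \<Longrightarrow> coords (S f *\<^sub>v v) = vec r (\<lambda>i. f i * coords v $ i)"
  using adjoint_U_U_vec by (simp add: S_vec coords_def)

lemma U_vec_carrier [simp]: "y \<in> carrier_vec r \<Longrightarrow> U *\<^sub>v y \<in> carrier_vec n"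
  by (rule mult_mat_vec_carrier[of _ n r]) auto

lemma S_vec_carrier [simp]: "v \<in> carrier_vec n \<Longrightarrow> S f *\<^sub>v v \<in> carrier_vec n"
  by (rule mult_mat_vec_carrier[of _ n n]) auto

text \<open>The factor \<open>U\<^sup>H U = I\<close> in the middle cancels. Testing on vectors with
  \<open>coords_S\<close> avoids reassociating a product of six matrices.\<close>

lemma S_mult: "S f * S g = S (\<lambda>i. f i * g i)"
proof -
  have "(S f * S g) *\<^sub>v v = S (\<lambda>i. f i * g i) *\<^sub>v v" if v: "v \<in> carrier_vec n" for v
  proof -
    have "(S f * S g) *\<^sub>v v = S f *\<^sub>v (S g *\<^sub>v v)"
      using v by (intro assoc_mult_mat_vec[of _ n n _ n]) auto
    also have "\<dots> = S (\<lambda>i. f i * g i) *\<^sub>v v"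
      using v by (simp add: S_vec[of "S g *\<^sub>v v"] coords_S)
        (simp add: S_vec mult_ac, intro arg_cong2[of _ _ _ _ "(*\<^sub>v)"] eq_vecI, auto)
    finally show ?thesis .
  qed
  then show ?thesis by (intro eq_mat_vecI[of _ n n]) (auto intro: mult_carrier_mat[of _ n n])
qed

text \<open>Cyclicity of the trace brings \<open>U\<^sup>H\<close> next to \<open>U\<close>, where
  they cancel.\<close>

lemma S_mtrace: "mtrace (S f) = complex_of_real (\<Sum>i<r. f i)"
proof -
  let ?F = "mat_diag r (\<lambda>i. complex_of_real (f i))"
  have "mtrace (S f) = mtrace (mat_adjoint U * (U * ?F))"
    unfolding S_def by (rule mtrace_mult_comm[of _ n r]) (auto intro: mult_carrier_mat[of _ n r])
  also have "mat_adjoint U * (U * ?F) = ?F"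
    using assoc_mult_mat[of "mat_adjoint U" r n U r ?F r] left_mult_one_mat[of ?F r r]
    by (simp add: U_isometry)
  finally show ?thesis by (simp add: mtrace_def mat_diag_def)
qed

lemma S_form:
  assumes "v \<in> carrier_vec n" "w \<in> carrier_vec n"
  shows "(S f *\<^sub>v v) \<bullet>c w = (\<Sum>i<r. f i * coords v $ i * cnj (coords w $ i))"
  using assms adjoint_cscalar_prod[of U n r "vec r (\<lambda>i. f i * coords v $ i)" w]
  by (simp add: S_vec coords_def[symmetric]) (simp add: cscalar_prod_sum)

lemma S_quad:
  assumes "v \<in> carrier_vec n"
  shows "(S f *\<^sub>v v) \<bullet>c v = complex_of_real (\<Sum>i<r. f i * (cmod (coords v $ i))\<^sup>2)"
  by (simp add: S_form assms complex_norm_square mult.assoc del: of_real_power)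

lemma vnorm2_S:
  assumes "v \<in> carrier_vec n"
  shows "vnorm2 (S f *\<^sub>v v) = (\<Sum>i<r. (f i)\<^sup>2 * (cmod (coords v $ i))\<^sup>2)"
proof -
  have "complex_of_real (vnorm2 (S f *\<^sub>v v))
    = complex_of_real (\<Sum>i<r. (f i)\<^sup>2 * (cmod (coords v $ i))\<^sup>2)"
    using assms
      by (simp only: vnorm2_mult[OF S_carrier] S_adjoint S_mult S_quad power2_eq_square[symmetric])
  then show ?thesis by (simp only: of_real_eq_iff)
qed

text \<open>The orthogonal projection onto the complement of the column span of \<open>U\<close>,
  which is the kernel of \<open>S f\<close> when \<open>f\<close> has no zero.\<close>

definition C :: "complex mat" where "C = 1\<^sub>m n - S (\<lambda>_. 1)"

lemma C_carrier [simp]: "C \<in> carrier_mat n n"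
  by (simp add: C_def minus_carrier_mat)

lemma C_dim [simp]: "dim_row C = n" "dim_col C = n"
  by (rule carrier_matD[OF C_carrier])+

lemma C_adjoint [simp]: "mat_adjoint C = C"
  by (simp add: C_def mat_adjoint_minus[of _ n n])

lemma S_C: "S f * C = 0\<^sub>m n n"
  by (simp add: C_def mult_minus_distrib_mat[of _ n n _ n] S_mult)

lemma C_S: "C * S f = 0\<^sub>m n n"
  by (simp add: C_def minus_mult_distrib_mat[of _ n n _ _ n] S_mult)

lemma C_C: "C * C = C"
proof -
  have "C * C = C * 1\<^sub>m n - C * S (\<lambda>_. 1)"
    by (subst (2) C_def) (rule mult_minus_distrib_mat[of _ n n _ n], auto)
  also have "\<dots> = C" by (simp add: C_S) (auto intro!: eq_matI)
  finally show ?thesis .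
qed

lemma C_vec: "v \<in> carrier_vec n \<Longrightarrow> C *\<^sub>v v = v - S (\<lambda>_. 1) *\<^sub>v v"
  by (simp add: C_def minus_mult_distrib_mat_vec[of _ n n])

lemma C_vec_carrier [simp]: "v \<in> carrier_vec n \<Longrightarrow> C *\<^sub>v v \<in> carrier_vec n"
  by (rule mult_mat_vec_carrier[of _ n n]) auto

lemma C_quad: "v \<in> carrier_vec n \<Longrightarrow> (C *\<^sub>v v) \<bullet>c v = complex_of_real (vnorm2 (C *\<^sub>v v))"
  using vnorm2_mult[of C n n v] by (simp add: C_C)

text \<open>Pythagoras for the splitting of \<open>v\<close> into its part in the column span and
  its part in the complement.\<close>

lemma vnorm2_split:
  assumes "v \<in> carrier_vec n"
  shows "vnorm2 v = (\<Sum>i<r. (cmod (coords v $ i))\<^sup>2) + vnorm2 (C *\<^sub>v v)"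
proof -
  have "complex_of_real (vnorm2 (C *\<^sub>v v)) = v \<bullet>c v - (S (\<lambda>_. 1) *\<^sub>v v) \<bullet>c v"
    using assms unfolding C_quad[OF assms, symmetric]
      by (simp add: C_vec minus_scalar_prod_distrib[of _ n])
  also have "\<dots> = complex_of_real (vnorm2 v - (\<Sum>i<r. (cmod (coords v $ i))\<^sup>2))"
    using assms by (simp add: S_quad cscalar_prod_self)
  finally show ?thesis by (simp only: of_real_eq_iff)
qed

lemma bessel: "v \<in> carrier_vec n \<Longrightarrow> (\<Sum>i<r. (cmod (coords v $ i))\<^sup>2) \<le> vnorm2 v"
  using vnorm2_split[of v] by simp

lemma S_psd:
  assumes "\<And>i. i < r \<Longrightarrow> 0 \<le> f i"
  shows "psd_mat n (S f)"
  using assms by (auto simp: psd_mat_def S_hermitian S_quad intro!: sum_nonneg)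

lemma C_psd: "psd_mat n C"
  by (auto simp: psd_mat_def hermitian_mat_def C_quad)

text \<open>\<open>C\<close> has trace \<open>n - r\<close>, and the trace of \<open>C = C * C\<^sup>H\<close> is nonnegative.\<close>
lemma r_le_n: "r \<le> n"
proof -
  have "complex_of_real ((frob_norm C)\<^sup>2) = mtrace C"
    using mtrace_mult_adjoint[of C] by (simp add: C_C)
  also have "\<dots> = complex_of_real (real n - real r)"
    by (simp add: C_def mtrace_minus[of _ n] S_mtrace) (simp add: mtrace_def)
  finally have "(frob_norm C)\<^sup>2 = real n - real r" by (simp only: of_real_eq_iff)
  then show ?thesis using zero_le_power2[of "frob_norm C"] by linarith
qed

section \<open>Columns of \<open>U\<close> as eigenvectors\<close>

lemma col_U_carrier [simp]: "i < r \<Longrightarrow> col U i \<in> carrier_vec n"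
  by (rule carrier_vecI) simp

lemma coords_col: "i < r \<Longrightarrow> coords (col U i) = unit_vec r i"
proof -
  assume i: "i < r"
  then have "coords (col U i) = col (mat_adjoint U * U) i"
    by (simp add: coords_def col_mult2[of _ r n _ r])
  then show ?thesis using i by (simp add: U_isometry)
qed

lemma coords_index: "v \<in> carrier_vec n \<Longrightarrow> i < r \<Longrightarrow> coords v $ i = v \<bullet>c col U i"
  unfolding coords_def
  by (subst mult_mat_vec_index[of _ r n]) (simp_all add: cscalar_prod_sum mult.commute)

lemma S_col: "i < r \<Longrightarrow> S f *\<^sub>v col U i = complex_of_real (f i) \<cdot>\<^sub>v col U i"
proof -
  assume i: "i < r"
  then have "S f *\<^sub>v col U i = U *\<^sub>v vec r (\<lambda>j. complex_of_real (f j) * unit_vec r i $ j)"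
    by (simp add: S_vec coords_col)
  also have "vec r (\<lambda>j. complex_of_real (f j) * unit_vec r i $ j)
    = complex_of_real (f i) \<cdot>\<^sub>v unit_vec r i"
    using i by (intro eq_vecI) auto
  also have "U *\<^sub>v \<dots> = complex_of_real (f i) \<cdot>\<^sub>v (U *\<^sub>v unit_vec r i)"
    by (rule mult_mat_vec[of _ n r]) auto
  finally show ?thesis using i by (simp add: mult_mat_unit_vec[of U n r])
qed

lemma vnorm2_col: "i < r \<Longrightarrow> vnorm2 (col U i) = 1"
proof -
  assume i: "i < r"
  have "complex_of_real (vnorm2 (col U i)) = (S (\<lambda>_. 1) *\<^sub>v col U i) \<bullet>c col U i"
    using S_col[OF i, of "\<lambda>_. 1"] by (simp add: cscalar_prod_self)
  also have "\<dots> = complex_of_real (\<Sum>j<r. (cmod (unit_vec r i $ j))\<^sup>2)"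
    using i by (simp add: S_quad coords_col)
  also have "(\<Sum>j<r. (cmod (unit_vec r i $ j))\<^sup>2) = (\<Sum>j<r. if j = i then 1 else 0)"
    using i by (intro sum.cong) auto
  finally show ?thesis using i by simp
qed

lemma col_U_nonzero: "i < r \<Longrightarrow> col U i \<noteq> 0\<^sub>v n"
  using vnorm2_col[of i] vnorm2_eq_0[of "col U i" n] by auto

lemma eigenvalue_S: "i < r \<Longrightarrow> eigenvalue (S f) (complex_of_real (f i))"
  unfolding eigenvalue_def eigenvector_def
  by (rule exI[of _ "col U i"])
    (simp only: S_dim col_U_carrier col_U_nonzero S_col simp_thms not_False_eq_True)

text \<open>In coordinates the eigenvector equation reads \<open>f i * y i = k * y i\<close>. Some
  coordinate is nonzero: otherwise \<open>k\<close> times the eigenvector would vanish although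
  \<open>k\<close> is nonzero.\<close>

lemma eigenvalue_SD:
  assumes "eigenvalue (S f) k" "k \<noteq> 0"
  shows "\<exists>i<r. k = complex_of_real (f i)"
proof -
  obtain v where v: "v \<in> carrier_vec n" "v \<noteq> 0\<^sub>v n" "S f *\<^sub>v v = k \<cdot>\<^sub>v v"
    using assms by (auto simp: eigenvalue_def eigenvector_def)
  have "vec r (\<lambda>i. f i * coords v $ i) = coords (k \<cdot>\<^sub>v v)"
    using v coords_S[of v f] by simp
  also have "\<dots> = k \<cdot>\<^sub>v coords v"
    using v by (simp add: coords_def mult_mat_vec[of _ r n])
  finally have veq: "vec r (\<lambda>i. f i * coords v $ i) = k \<cdot>\<^sub>v coords v" .
  have eq: "f i * coords v $ i = k * coords v $ i" if i: "i < r" for i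
  proof -
    have "vec r (\<lambda>i. f i * coords v $ i) $ i = (k \<cdot>\<^sub>v coords v) $ i" by (simp only: veq)
    then show ?thesis using i by simp
  qed
  have "\<exists>i<r. coords v $ i \<noteq> 0"
  proof (rule ccontr)
    assume "\<not> ?thesis"
    then have "vnorm2 (S f *\<^sub>v v) = 0" using v(1) by (simp add: vnorm2_S)
    then have "vnorm2 v = 0" using v assms(2) by (simp add: vnorm2_smult)
    then show False using v vnorm2_eq_0 by auto
  qed
  then obtain i where i: "i < r" "coords v $ i \<noteq> 0" by blast
  with eq[of i] have "k = complex_of_real (f i)" by simp
  with i show ?thesis by blast
qed

end

subsection \<open>The spectral theorem for positive semidefinite matrices\<close>

text \<open>If all eigenvalues vanish, then the Schur form is strictly upper triangular, so that
  the trace of \<open>A\<^sup>2\<close>, which is the squared Frobenius norm of \<open>A\<close>, is zero.\<close>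
lemma hermitian_nonzero_eigenvalue:
  assumes "hermitian_mat n A" "A \<noteq> 0\<^sub>m n n"
  shows "\<exists>k. eigenvalue A k \<and> k \<noteq> 0"
proof (rule ccontr)
  assume no: "\<not> ?thesis"
  have A: "A \<in> carrier_mat n n" "mat_adjoint A = A" using assms(1) by (auto simp: hermitian_mat_def)
  obtain as where as: "char_poly A = (\<Prod>a\<leftarrow>as. [:- a, 1:])" "length as = n"
    using char_poly_factorized[OF A(1)] by auto
  obtain B P Q where schur: "schur_decomposition A as = (B, P, Q)"
    by (cases "schur_decomposition A as")
  from schur_decomposition[OF A(1) as(1) schur]
  have sim: "similar_mat_wit A B P Q" and up: "upper_triangular B" and diag: "diag_mat B = as"
    by auto
  from similar_mat_witD2[OF A(1) sim]
  have QP: "Q * P = 1\<^sub>m n" and ABPQ: "A = P * B * Q"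
    and c: "B \<in> carrier_mat n n" "P \<in> carrier_mat n n" "Q \<in> carrier_mat n n"
    by auto
  have zero: "a = 0" if "a \<in> set as" for a
  proof -
    have "poly (char_poly A) a = 0"
      using that unfolding as(1) by (induction as) auto
    then show ?thesis using eigenvalue_root_char_poly[OF A(1)] no by blast
  qed
  have diag0: "B $$ (i, i) = 0" if "i < n" for i
    using that zero[of "diag_mat B ! i"] c as(2) unfolding diag[symmetric]
      by (auto simp: diag_mat_def)
  have low0: "B $$ (i, j) = 0" if "i < n" "j \<le> i" for i j
    using that diag0 up c by (cases "j = i") (auto simp: upper_triangular_def)
  have "mtrace (B * B) = 0"
    unfolding mtrace_mult[OF c(1,1)]
  proof (intro sum.neutral ballI)
    fix i j assume "i \<in> {..<n}" "j \<in> {..<n}"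
    then show "B $$ (i, j) * B $$ (j, i) = 0"
      using low0[of i j] low0[of j i] by (cases "j \<le> i") auto
  qed
  have BQ: "B * Q \<in> carrier_mat n n" and PB: "P * B \<in> carrier_mat n n" using c by auto
  have "A * A = P * (B * (B * Q))"
  proof -
    have "A * A = P * (B * Q * (P * (B * Q)))"
      using c BQ by
        (simp add: ABPQ assoc_mult_mat[of P n n B n Q n] assoc_mult_mat[of P n n "B * Q" n "P * (B * Q)" n])
    also have "B * Q * (P * (B * Q)) = B * (Q * (P * (B * Q)))"
      using c BQ by (intro assoc_mult_mat[of _ n n _ n _ n]) auto
    also have "Q * (P * (B * Q)) = Q * P * (B * Q)"
      using c BQ by (intro assoc_mult_mat[symmetric, of _ n n _ n _ n]) auto
    finally show ?thesis using BQ by (simp add: QP left_mult_one_mat[OF BQ])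
  qed
  \<comment> \<open>\<open>P\<close> and \<open>Q\<close> are used only as mutual inverses:
    cyclicity of the trace brings them together, and the trace of \<open>B * B\<close>
    remains.\<close>
  then have "mtrace (A * A) = mtrace (B * (B * Q) * P)"
    using c BQ by (simp add: mtrace_mult_comm[of P n n])
  also have "B * (B * Q) * P = B * (B * Q * P)"
    using c BQ by (intro assoc_mult_mat[of _ n n _ n _ n]) auto
  also have "B * Q * P = B * (Q * P)"
    using c BQ by (intro assoc_mult_mat[of _ n n _ n _ n]) auto
  also have "B * (Q * P) = B" using c by (simp add: QP)
  finally have "(frob_norm A)\<^sup>2 = 0"
    using mtrace_mult_adjoint[of A] A \<open>mtrace (B * B) = 0\<close> by simp
  then show False using frob_norm_eq_0[OF A(1)] assms(2) by simp
qed

text \<open>The Gram matrix of the columns gains a border of zeros, by orthogonality, and a corner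
  entry one, by normalization.\<close>

lemma isometry_extend:
  assumes "isometry n r U" "v \<in> carrier_vec n" "vnorm2 v = 1" "\<And>i. i < r \<Longrightarrow> v \<bullet>c col U i = 0"
  shows "isometry n (Suc r) (mat n (Suc r) (\<lambda>(i, j). if j < r then U $$ (i, j) else v $ i))"
    (is "isometry n _ ?V")
proof
  interpret isometry n r U by fact
  have entry: "(mat_adjoint ?V * ?V) $$ (a, b) = col ?V b \<bullet>c col ?V a" if "a < Suc r" "b < Suc r"
    for a b
    using that by (subst mult_mat_index[of _ "Suc r" n _ "Suc r"])
      (auto simp: cscalar_prod_sum mult.commute intro!: sum.cong)
  have col: "col ?V a = (if a < r then col U a else v)" if "a < Suc r" for a
    using that assms(2) by (intro eq_vecI) auto
  have UU: "col U b \<bullet>c col U a = (if a = b then 1 else 0)" if "a < r" "b < r" for a b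
    using that coords_index[of "col U b" a] coords_col[of b] by auto
  have vU: "col U a \<bullet>c v = 0" if "a < r" for a
    using cscalar_prod_cnj[of v "col U a"] assms(2,4) that by simp
  show "mat_adjoint ?V * ?V = 1\<^sub>m (Suc r)"
  proof (rule eq_matI)
    fix a b assume
      "a < dim_row (1\<^sub>m (Suc r) :: complex mat)" "b < dim_col (1\<^sub>m (Suc r) :: complex mat)"
    then have ab: "a < Suc r" "b < Suc r" by auto
    show "(mat_adjoint ?V * ?V) $$ (a, b) = 1\<^sub>m (Suc r) $$ (a, b)"
      unfolding entry[OF ab] col[OF ab(1)] col[OF ab(2)]
      using ab assms(3,4) by (auto simp: UU vU cscalar_prod_self vnorm2_col)
  qed auto
qed auto

text \<open>Deflation: take a maximal orthonormal family of eigenvectors with nonzero eigenvalues.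
  If \<open>A\<close> were not yet exhausted, an eigenvector of the remainder would extend the family.\<close>
lemma hermitian_reduced_spectral:
  assumes A: "hermitian_mat n A"
  shows "\<exists>r U f. isometry n r U \<and> (\<forall>i<r. f i \<noteq> 0) \<and> A = isometry.S r U f"
proof -
  have Ac: "A \<in> carrier_mat n n" "mat_adjoint A = A" using A by (auto simp: hermitian_mat_def)
  define E where "E r \<longleftrightarrow> (\<exists>U f. isometry n r U \<and>
     (\<forall>i<r. f i \<noteq> 0 \<and> A *\<^sub>v col U i = complex_of_real (f i) \<cdot>\<^sub>v col U i))" for r
  have "isometry n 0 (mat n 0 (\<lambda>_. 0))" by standard (auto intro!: eq_matI)
  then have "E 0" by (auto simp: E_def)
  \<comment> \<open>Orthonormal families in dimension \<open>n\<close> have at most \<open>n\<close>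
    members, so a largest admissible \<open>r\<close> exists.\<close>
  moreover have "\<forall>r. E r \<longrightarrow> r \<le> n" by (auto simp: E_def intro: isometry.r_le_n)
  ultimately obtain r where r: "E r" "\<And>k. E k \<Longrightarrow> k \<le> r"
    using GreatestI_nat[of E 0 n] Greatest_le_nat[of E _ n] by metis
  then obtain U f where iso: "isometry n r U" and f: "\<And>i. i < r \<Longrightarrow> f i \<noteq> 0"
    and ev: "\<And>i. i < r \<Longrightarrow> A *\<^sub>v col U i = complex_of_real (f i) \<cdot>\<^sub>v col U i"
    using r(1) unfolding E_def by blast
  interpret isometry n r U by fact
  define B where "B = A - S f"
  have B: "B \<in> carrier_mat n n" "mat_adjoint B = B" using Ac
    by (auto simp: B_def mat_adjoint_minus[of A n n "S f"] minus_carrier_mat)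
  then have herm: "hermitian_mat n B" by (simp add: hermitian_mat_def)
  have Bcol: "B *\<^sub>v col U i = 0\<^sub>v n" if "i < r" for i
    using Ac that ev[OF that] S_col[OF that]
    by (auto simp: B_def minus_mult_distrib_mat_vec[of A n n "S f"] intro!: eq_vecI)
  have "B = 0\<^sub>m n n"
  proof (rule ccontr)
    assume "B \<noteq> 0\<^sub>m n n"
    then obtain k w where k: "k \<noteq> 0" and w: "w \<in> carrier_vec n" "w \<noteq> 0\<^sub>v n" "B *\<^sub>v w = k \<cdot>\<^sub>v w"
      using hermitian_nonzero_eigenvalue[OF herm] B by (auto simp: eigenvalue_def eigenvector_def)
    define v where "v = complex_of_real (1 / sqrt (vnorm2 w)) \<cdot>\<^sub>v w"
    have v: "v \<in> carrier_vec n" using w by (simp add: v_def)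
    have v1: "vnorm2 v = 1"
      unfolding v_def vnorm2_smult using vnorm2_pos[OF w(1,2)]
        by (simp add: power_divide norm_divide)
    have Bv: "B *\<^sub>v v = k \<cdot>\<^sub>v v"
      using B w unfolding v_def
        by (simp add: mult_mat_vec[of B n n w] smult_smult_assoc mult.commute)
    \<comment> \<open>On the unit vector \<open>v\<close> the Hermitian form of \<open>B\<close>
      takes the value \<open>k\<close>; hence \<open>k\<close> is real and can serve as a new value
      of \<open>f\<close>.\<close>
    have "k = complex_of_real (Re k)"
      using hermitian_form_real[OF herm v] v v1 by (simp add: Bv cscalar_prod_self)
    then obtain x where x: "k = complex_of_real x" by blast
    \<comment> \<open>\<open>B\<close> annihilates every old column, and \<open>k\<close> is
      nonzero, so moving \<open>B\<close> across the inner product forces orthogonality.\<close>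
    have orth: "v \<bullet>c col U i = 0" if "i < r" for i
    proof -
      have "k * (v \<bullet>c col U i) = (B *\<^sub>v v) \<bullet>c col U i"
        using v that by (simp add: Bv)
      also have "\<dots> = v \<bullet>c (B *\<^sub>v col U i)"
        using adjoint_cscalar_prod[of B n n v "col U i"] B v that by simp
      finally show ?thesis using k v by (simp add: Bcol[OF that])
    qed
    \<comment> \<open>By orthogonality the subtracted part \<open>S f\<close> does not see
      \<open>v\<close>, so an eigenvector of the remainder \<open>B\<close> is one of
      \<open>A\<close> with the same eigenvalue.\<close>
    have "vnorm2 (S f *\<^sub>v v) = 0"
      using v orth by (simp add: vnorm2_S coords_index)
    then have "S f *\<^sub>v v = 0\<^sub>v n" using v by (simp add: vnorm2_eq_0[of _ n])
    moreover have "B *\<^sub>v v = A *\<^sub>v v - S f *\<^sub>v v"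
      using v Ac by (simp add: B_def minus_mult_distrib_mat_vec[of A n n "S f"])
    ultimately have Av: "A *\<^sub>v v = k \<cdot>\<^sub>v v" using Bv v Ac
      by (metis minus_zero_vec mult_mat_vec_carrier)
    let ?V = "mat n (Suc r) (\<lambda>(i, j). if j < r then U $$ (i, j) else v $ i)"
    have col: "col ?V a = (if a < r then col U a else v)" if "a < Suc r" for a
      using that v by (intro eq_vecI) auto
    have "E (Suc r)"
      unfolding E_def
      using isometry_extend[OF iso v v1 orth] f ev Av k x
      by (intro exI[of _ ?V] exI[of _ "\<lambda>i. if i < r then f i else x"])
        (auto simp: col simp del: col_mat)
    then show False using r(2) by fastforce
  qed
  then have "(A - S f) $$ (i, j) = 0" if "i < n" "j < n" for i j using that by (simp add: B_def)
  then have "A = S f" using Ac by (intro eq_matI) auto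
  then show ?thesis using iso f by blast
qed

text \<open>Each \<open>f i\<close> is the value of the quadratic form at a unit column, hence
  nonnegative, and it is nonzero already.\<close>

lemma psd_reduced_spectral:
  assumes "psd_mat n A"
  obtains r U f where "isometry n r U" "\<And>i. i < r \<Longrightarrow> 0 < f i" "A = isometry.S r U f"
proof -
  obtain r U f where iso: "isometry n r U" and f: "\<And>i. i < r \<Longrightarrow> f i \<noteq> 0"
    and A: "A = isometry.S r U f"
    using hermitian_reduced_spectral[of n A] assms by (auto simp: psd_mat_def)
  interpret isometry n r U by fact
  have "0 < f i" if i: "i < r" for i
  proof -
    have "0 \<le> Re ((A *\<^sub>v col U i) \<bullet>c col U i)"
      using assms i by (auto simp: psd_mat_def)
    then have "0 \<le> f i" using i by (simp add: A S_col cscalar_prod_self vnorm2_col)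
    with f[OF i] show ?thesis by simp
  qed
  with iso A that show ?thesis by blast
qed

subsection \<open>Pseudoinverse, null space projection and rank\<close>

text \<open>From \<open>A X = A Y A X\<close> and the Hermitian symmetry of \<open>A X\<close> and
  \<open>A Y\<close>, taking adjoints gives \<open>A X = A X A Y = A Y\<close>; likewise
  \<open>X A = Y A\<close>. Then \<open>X = X A X = Y A X = Y A Y = Y\<close>.\<close>

lemma is_pseudoinverse_unique:
  assumes X: "is_pseudoinverse A X" and Y: "is_pseudoinverse A Y"
  shows "X = Y"
proof -
  obtain m n where A: "A \<in> carrier_mat m n" by (meson carrier_matI)
  have c: "X \<in> carrier_mat n m"
    "Y \<in> carrier_mat n m" "A * X \<in> carrier_mat m m" "A * Y \<in> carrier_mat m m"
    "X * A \<in> carrier_mat n n" "Y * A \<in> carrier_mat n n"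
    using X Y A by (auto simp: is_pseudoinverse_def)
  have x: "A * X * A = A" "X * A * X = X" "mat_adjoint (A * X) = A * X" "mat_adjoint (X * A)
    = X * A"
    using X by (auto simp: is_pseudoinverse_def)
  have y: "A * Y * A = A" "Y * A * Y = Y" "mat_adjoint (A * Y) = A * Y" "mat_adjoint (Y * A)
    = Y * A"
    using Y by (auto simp: is_pseudoinverse_def)
  have "A * X = A * Y * A * X" using y(1) by simp
  also have "\<dots> = A * Y * (A * X)" using A c by (intro assoc_mult_mat[of _ m m _ n _ m]) auto
  finally have AX: "A * X = A * Y * (A * X)" .
  have "A * Y = A * X * A * Y" using x(1) by simp
  also have "\<dots> = A * X * (A * Y)" using A c by (intro assoc_mult_mat[of _ m m _ n _ m]) auto
  finally have AY: "A * X * (A * Y) = A * Y" by simp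
  have "A * X = mat_adjoint (A * Y * (A * X))" using AX x(3) by simp
  also have "\<dots> = A * X * (A * Y)" using c by (simp add: mat_adjoint_mult[of _ m m _ m] x y)
  finally have 1: "A * X = A * Y" using AY by simp
  have "X * A = X * (A * Y * A)" using y(1) by simp
  also have "\<dots> = X * (A * (Y * A))" using A c by (subst assoc_mult_mat[of A m n Y m A n]) auto
  also have "\<dots> = X * A * (Y * A)" using A c
    by (intro assoc_mult_mat[symmetric, of _ n m _ n _ n]) auto
  finally have XA: "X * A * (Y * A) = X * A" by simp
  have "Y * A = Y * (A * X * A)" using x(1) by simp
  also have "\<dots> = Y * (A * (X * A))" using A c by (subst assoc_mult_mat[of A m n X m A n]) auto
  also have "\<dots> = Y * A * (X * A)" using A c
    by (intro assoc_mult_mat[symmetric, of _ n m _ n _ n]) auto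
  finally have YA: "Y * A * (X * A) = Y * A" by simp
  have "X * A = mat_adjoint (X * A * (Y * A))" using XA x(4) by simp
  also have "\<dots> = Y * A * (X * A)" using c by (simp add: mat_adjoint_mult[of _ n n _ n] x y)
  finally have 2: "X * A = Y * A" using YA by simp
  have "X = Y * A * X" using x(2) 2 by simp
  also have "\<dots> = Y * (A * X)" using A c by (intro assoc_mult_mat[of _ n m _ n _ m]) auto
  also have "\<dots> = Y * A * Y" unfolding 1 using A c
    by (intro assoc_mult_mat[symmetric, of _ n m _ n _ m]) auto
  finally show ?thesis using y(2) by simp
qed

lemma pseudoinverse_eqI: "is_pseudoinverse A X \<Longrightarrow> pseudoinverse A = X"
  unfolding pseudoinverse_def using is_pseudoinverse_unique by blast

lemma is_orth_proj_unique:
  assumes X: "is_orth_proj n W X" and Y: "is_orth_proj n W Y"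
  shows "X = Y"
proof (rule eq_mat_vecI[of _ n n])
  show "X \<in> carrier_mat n n" "Y \<in> carrier_mat n n" using X Y by (auto simp: is_orth_proj_def)
  then have c: "X *\<^sub>v v \<in> carrier_vec n" "Y *\<^sub>v v \<in> carrier_vec n" for v
    by (auto intro: carrier_vecI)
  fix v :: "complex vec" assume v: "v \<in> carrier_vec n"
  let ?x = "X *\<^sub>v v" and ?y = "Y *\<^sub>v v"
  have sub: "(v - z) \<bullet>c w = v \<bullet>c w - z \<bullet>c w" if "z \<in> carrier_vec n" "w \<in> carrier_vec n" for z w
    using v that by (simp add: minus_scalar_prod_distrib[of _ n])
  \<comment> \<open>Only \<open>?x\<close> and \<open>?y\<close> are known to lie in
    \<open>W\<close>, so the norm of their difference is expanded into inner products against these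
    two, and the terms cancel.\<close>
  have inner: "?x \<bullet>c w = v \<bullet>c w \<and> ?y \<bullet>c w = v \<bullet>c w" if "w \<in> {?x, ?y}" for w
  proof -
    have "(v - ?x) \<bullet>c w = 0" "(v - ?y) \<bullet>c w = 0"
      using X Y v that by (auto simp: is_orth_proj_def)
    moreover have "w \<in> carrier_vec n" using c that by auto
    ultimately show ?thesis using c by (simp add: sub)
  qed
  have "vnorm2 (?x - ?y) = 0"
    using vnorm2_diff[OF c, of v v] inner by simp
  then have "?x - ?y = 0\<^sub>v n" using vnorm2_eq_0[of "?x - ?y" n] c by simp
  then have "(?x - ?y) $ i = 0" if "i < n" for i using that by simp
  then show "?x = ?y" using c
    by (intro eq_vecI)
      (auto simp: carrier_vecD[OF c(1)] carrier_vecD[OF c(2)] simp del: dim_mult_mat_vec index_mult_mat_vec)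
qed

lemma null_proj_eqI: "is_orth_proj (dim_col A) (mat_kernel A) X \<Longrightarrow> null_proj A = X"
  unfolding null_proj_def using is_orth_proj_unique by blast

context isometry
begin

text \<open>Both products with the candidate equal the Hermitian projection
  \<open>S (\<lambda>_. 1)\<close>, so the Penrose conditions hold pointwise.\<close>

lemma pseudoinverse_S:
  assumes "\<And>i. i < r \<Longrightarrow> f i \<noteq> 0"
  shows "pseudoinverse (S f) = S (\<lambda>i. 1 / f i)"
  by (rule pseudoinverse_eqI)
    (use assms in \<open>auto simp: is_pseudoinverse_def S_mult intro!: S_cong\<close>)

lemma coords_C: "v \<in> carrier_vec n \<Longrightarrow> coords (C *\<^sub>v v) = 0\<^sub>v r"
  using mult_minus_distrib_mat_vec[of "mat_adjoint U" r n v "S (\<lambda>_. 1) *\<^sub>v v"]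
  by (simp add: C_vec coords_def[symmetric] coords_S) (auto intro!: eq_vecI)

lemma null_proj_eq:
  assumes H: "H \<in> carrier_mat m n"
    and ker: "\<And>v. v \<in> carrier_vec n \<Longrightarrow> H *\<^sub>v v = 0\<^sub>v m \<longleftrightarrow> coords v = 0\<^sub>v r"
  shows "null_proj H = C"
proof (rule null_proj_eqI)
  have "(v - C *\<^sub>v v) \<bullet>c w = 0" if "v \<in> carrier_vec n" "w \<in> carrier_vec n" "coords w = 0\<^sub>v r"
    for v w
  proof -
    have "v - C *\<^sub>v v = S (\<lambda>_. 1) *\<^sub>v v" using that by (auto simp: C_vec intro!: eq_vecI)
    then show ?thesis using that by (simp add: S_form)
  qed
  then show "is_orth_proj (dim_col H) (mat_kernel H) C"
    using H by (auto simp: is_orth_proj_def mat_kernel_def ker coords_C)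
qed

text \<open>\<open>H\<close> and \<open>H U\<close> have the same column space, because
  \<open>H\<close> kills the complement of the span of \<open>U\<close>; and the \<open>r\<close>
  columns of \<open>H U\<close> are independent, because \<open>H\<close> is injective on that
  span.\<close>

lemma rank_eq:
  assumes H: "H \<in> carrier_mat m n"
    and ker: "\<And>v. v \<in> carrier_vec n \<Longrightarrow> H *\<^sub>v v = 0\<^sub>v m \<longleftrightarrow> coords v = 0\<^sub>v r"
  shows "vec_space.rank m H = r"
proof -
  interpret vec_space "TYPE(complex)" m .
  have HU: "H * U \<in> carrier_mat m r" using H by (rule mult_carrier_mat) simp
  have HUv: "(H * U) *\<^sub>v y = H *\<^sub>v (U *\<^sub>v y)" if "y \<in> carrier_vec r" for y
    using H that by (intro assoc_mult_mat_vec[of _ m n _ r]) auto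
  have HS: "H *\<^sub>v v = (H * U) *\<^sub>v coords v" if v: "v \<in> carrier_vec n" for v
  proof -
    have "C *\<^sub>v v + S (\<lambda>_. 1) *\<^sub>v v = v"
      using v by (auto simp: C_vec intro!: eq_vecI)
    then have "H *\<^sub>v v = H *\<^sub>v (C *\<^sub>v v + S (\<lambda>_. 1) *\<^sub>v v)" by simp
    also have "\<dots> = H *\<^sub>v (C *\<^sub>v v) + H *\<^sub>v (S (\<lambda>_. 1) *\<^sub>v v)"
      using H v by (intro mult_add_distrib_mat_vec[of _ m n]) auto
    also have "H *\<^sub>v (C *\<^sub>v v) = 0\<^sub>v m" using v by (simp add: ker coords_C)
    also have "S (\<lambda>_. 1) *\<^sub>v v = U *\<^sub>v coords v"
      using v by (simp add: S_vec) (intro arg_cong2[of _ _ _ _ "(*\<^sub>v)"] eq_vecI, auto)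
    finally show ?thesis using H v HUv[of "coords v"] by (auto intro!: eq_vecI)
  qed
  have inj: "y = 0\<^sub>v r" if "y \<in> carrier_vec r" "(H * U) *\<^sub>v y = 0\<^sub>v m" for y
    using that ker[of "U *\<^sub>v y"] HUv[of y] by (simp add: coords_def adjoint_U_U_vec)
  have "{y. \<exists>x\<in>carrier_vec n. H *\<^sub>v x = y} = {y. \<exists>x\<in>carrier_vec r. (H * U) *\<^sub>v x = y}"
    using HS HUv coords_carrier U_vec_carrier by metis
  then have "col_space H = col_space (H * U)"
    unfolding col_space_eq[OF H] col_space_eq[OF HU] using H HU by auto
  then have "rank H = rank (H * U)" by (simp add: rank_def col_space_def)
  \<comment> \<open>Linear independence is stated for the set of columns, which would hide
    repetitions, so these are excluded separately.\<close>
  moreover have "distinct (cols (H * U))"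
    unfolding distinct_conv_nth
  proof (intro allI impI notI)
    fix i j assume ij: "i < length (cols (H * U))" "j < length (cols (H * U))" "i \<noteq> j"
      and eq: "cols (H * U) ! i = cols (H * U) ! j"
    have ij': "i < r" "j < r" using ij HU by auto
    have "(H * U) *\<^sub>v (unit_vec r i - unit_vec r j) = col (H * U) i - col (H * U) j"
      using mult_mat_unit_vec[OF HU ij'(1)] mult_mat_unit_vec[OF HU ij'(2)]
        mult_minus_distrib_mat_vec[OF HU, of "unit_vec r i" "unit_vec r j"] by simp
    also have "\<dots> = 0\<^sub>v m" using eq ij HU H by auto
    finally have "unit_vec r i - unit_vec r j = (0\<^sub>v r :: complex vec)" by (intro inj) auto
    then have "(unit_vec r i - unit_vec r j) $ i = (0 :: complex)" using ij' by simp
    then show False using ij' ij(3) by simp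
  qed
  moreover have "\<not> lin_dep (set (cols (H * U)))"
    using lin_depE[OF HU] inj calculation(2) by metis
  ultimately show ?thesis using lin_indpt_full_rank[OF HU] by simp
qed

end

text \<open>Writing \<open>M\<close> as a sum of \<open>f i\<close> times the rank-one projections
  onto its eigenvectors, the trace becomes a sum of \<open>f i\<close> times values of the quadratic
  form of \<open>Z\<close>.\<close>

lemma mtrace_psd_mult_nonneg:
  assumes "psd_mat n M" "psd_mat n Z"
  shows "0 \<le> Re (mtrace (M * Z))"
proof -
  obtain r U f where iso: "isometry n r U" and f: "\<And>i. i < r \<Longrightarrow> 0 < f i"
    and M: "M = isometry.S r U f"
    using psd_reduced_spectral[OF assms(1)] by blast
  interpret isometry n r U by fact
  have Z: "Z \<in> carrier_mat n n" using assms by (auto simp: psd_mat_def hermitian_mat_def)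
  have form: "(Z *\<^sub>v col U i) \<bullet>c col U i
    = (\<Sum>b<n. \<Sum>a<n. Z $$ (b, a) * U $$ (a, i) * cnj (U $$ (b, i)))"
    if "i < r" for i
    using that mult_mat_vec_index[OF Z, of "col U i"]
    by (simp add: cscalar_prod_sum sum_distrib_right del: index_mult_mat_vec)
  have "mtrace (M * Z) = (\<Sum>a<n. \<Sum>b<n. \<Sum>i<r. f i * (Z $$ (b, a) * U $$ (a, i) * cnj (U $$ (b, i))))"
    unfolding M mtrace_mult[OF S_carrier Z] by (simp add: S_index sum_distrib_left mult_ac)
  also have "\<dots> = (\<Sum>a<n. \<Sum>i<r. \<Sum>b<n. f i * (Z $$ (b, a) * U $$ (a, i) * cnj (U $$ (b, i))))"
    by (intro sum.cong refl sum.swap)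
  also have "\<dots> = (\<Sum>i<r. \<Sum>a<n. \<Sum>b<n. f i * (Z $$ (b, a) * U $$ (a, i) * cnj (U $$ (b, i))))"
    by (rule sum.swap)
  also have "\<dots> = (\<Sum>i<r. f i * ((Z *\<^sub>v col U i) \<bullet>c col U i))"
    by (intro sum.cong refl, subst sum.swap) (simp add: form sum_distrib_left)
  finally have "Re (mtrace (M * Z)) = (\<Sum>i<r. f i * Re ((Z *\<^sub>v col U i) \<bullet>c col U i))" by simp
  also have "\<dots> \<ge> 0"
    using assms(2) f by (intro sum_nonneg mult_nonneg_nonneg) (auto simp: psd_mat_def less_imp_le)
  finally show ?thesis .
qed

subsection \<open>The projection onto the strategy set\<close>

lemma psd_mat_add:
  assumes "psd_mat n A" "psd_mat n B"
  shows "psd_mat n (A + B)"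
proof -
  have c: "A \<in> carrier_mat n n" "B \<in> carrier_mat n n" "mat_adjoint A = A" "mat_adjoint B = B"
    using assms by (auto simp: psd_mat_def hermitian_mat_def)
  have "((A + B) *\<^sub>v v) \<bullet>c v = (A *\<^sub>v v) \<bullet>c v + (B *\<^sub>v v) \<bullet>c v" if "v \<in> carrier_vec n" for v
    using that c by (simp add: add_mult_distrib_mat_vec[of A n n B] add_scalar_prod_distrib[of _ n])
  then show ?thesis using assms c
    by (simp add: psd_mat_def hermitian_mat_def mat_adjoint_add[of A n n B])
qed

lemma psd_mat_smult:
  assumes "psd_mat n A" "0 \<le> c"
  shows "psd_mat n (complex_of_real c \<cdot>\<^sub>m A)"
proof -
  have A: "A \<in> carrier_mat n n" "mat_adjoint A = A"
    using assms by (auto simp: psd_mat_def hermitian_mat_def)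
  have "((complex_of_real c \<cdot>\<^sub>m A) *\<^sub>v v) \<bullet>c v = complex_of_real c * ((A *\<^sub>v v) \<bullet>c v)"
    if "v \<in> carrier_vec n" for v
  proof -
    have "(complex_of_real c \<cdot>\<^sub>m A) *\<^sub>v v = complex_of_real c \<cdot>\<^sub>v (A *\<^sub>v v)"
      using that A by (intro eq_vecI) auto
    then show ?thesis using that A by simp
  qed
  then show ?thesis using assms A
    by (auto simp: psd_mat_def hermitian_mat_def mat_adjoint_smult_real)
qed

text \<open>The law of cosines and \<open>var\<close> give a Pythagorean inequality. Its term
  \<open>(frob_norm (Z - W))\<^sup>2\<close> yields uniqueness of the minimizer, which is needed
  because \<open>arg_min_on\<close> may choose any minimizer.\<close>

lemma strategy_proj_eqI:
  assumes W: "W \<in> strategy_set n p" and X: "X \<in> carrier_mat n n"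
    and var: "\<And>Z. Z \<in> strategy_set n p \<Longrightarrow> 0 \<le> Re (mtrace ((W - X) * (Z - W)))"
  shows "strategy_proj n p X = W"
proof -
  have herm: "hermitian_mat n Z" if "Z \<in> strategy_set n p" for Z
    using that by (auto simp: strategy_set_def psd_mat_def)
  then have carr: "Z \<in> carrier_mat n n" if "Z \<in> strategy_set n p" for Z
    using that by (auto simp: hermitian_mat_def)
  have ineq: "(frob_norm (W - X))\<^sup>2 + (frob_norm (Z - W))\<^sup>2 \<le> (frob_norm (Z - X))\<^sup>2"
    if Z: "Z \<in> strategy_set n p" for Z
  proof -
    have "hermitian_mat n (Z - W)"
      using herm[OF Z] herm[OF W] by (auto simp: hermitian_mat_def mat_adjoint_minus[of Z n n W])
    moreover have "Z - X = (W - X) + (Z - W)" using carr[OF Z] carr[OF W] X by (intro eq_matI) auto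
    moreover have "W - X \<in> carrier_mat n n" using carr[OF W] X by (auto simp: minus_carrier_mat)
    ultimately show ?thesis using frob_norm_add_sq[of "W - X" n "Z - W"] var[OF Z] by simp
  qed
  show ?thesis
    unfolding strategy_proj_def arg_min_on_def
  proof (rule arg_minI)
    show "W \<in> strategy_set n p" by fact
  next
    fix Z assume Z: "Z \<in> strategy_set n p"
    have "(frob_norm (W - X))\<^sup>2 \<le> (frob_norm (Z - X))\<^sup>2"
      using ineq[OF Z] zero_le_power2[of "frob_norm (Z - W)"] by linarith
    then show "\<not> frob_norm (Z - X) < frob_norm (W - X)"
      using power2_le_imp_le[OF _ frob_norm_nonneg] by fastforce
  next
    fix Z assume Z: "Z \<in> strategy_set n p"
      and min: "\<forall>y. y \<in> strategy_set n p \<longrightarrow> \<not> frob_norm (y - X) < frob_norm (Z - X)"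
    then have "frob_norm (Z - X) \<le> frob_norm (W - X)" using W by fastforce
    then have "(frob_norm (Z - X))\<^sup>2 \<le> (frob_norm (W - X))\<^sup>2" by (intro power_mono) auto
    then have "(frob_norm (Z - W))\<^sup>2 \<le> 0" using ineq[OF Z] by linarith
    then have "frob_norm (Z - W) = 0" by simp
    then have "Z - W = 0\<^sub>m n n" using carr[OF Z] carr[OF W]
      by (intro frob_norm_eq_0) (auto simp: minus_carrier_mat)
    then have "(Z - W) $$ (i, j) = 0" if "i < n" "j < n" for i j using that by simp
    then show "Z = W" using carr[OF Z] carr[OF W] by (intro eq_matI) auto
  qed
qed

context isometry
begin

text \<open>With \<open>X = - (S (1/f) + c C)\<close> one has \<open>W - X = \<mu> I + M\<close> where \<open>M\<close> is positive
  semidefinite and \<open>M W = 0\<close>. Hence, on matrices of equal trace, the linear functional given by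
  \<open>W - X\<close> is minimal at \<open>W\<close>.\<close>
lemma strategy_proj_waterfilling:
  assumes p: "0 < p" and sum: "(\<Sum>i<r. max 0 (\<mu> - 1 / f i)) = p"
    and c: "\<And>i. i < r \<Longrightarrow> p + 1 / f i \<le> c"
  shows "strategy_proj n p (- (S (\<lambda>i. 1 / f i) + complex_of_real c \<cdot>\<^sub>m C))
    = S (\<lambda>i. max 0 (\<mu> - 1 / f i))"
proof (rule strategy_proj_eqI)
  let ?w = "\<lambda>i. max 0 (\<mu> - 1 / f i)" and ?m = "\<lambda>i. max 0 (1 / f i - \<mu>)"
  let ?X = "- (S (\<lambda>i. 1 / f i) + complex_of_real c \<cdot>\<^sub>m C)"
  define M where "M = S ?m + complex_of_real (c - \<mu>) \<cdot>\<^sub>m C"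
  show W: "S ?w \<in> strategy_set n p"
    unfolding strategy_set_def using S_psd[of ?w] S_mtrace[of ?w] sum by simp
  show "?X \<in> carrier_mat n n" by (auto intro: carrier_matI)
  \<comment> \<open>A channel that receives power receives at most \<open>p\<close>, so
    \<open>\<mu> \<le> p + 1 / f i \<le> c\<close> there. This makes the coefficient of
    \<open>C\<close> in \<open>M\<close> nonnegative.\<close>
  have "\<exists>i<r. 0 < ?w i"
  proof (rule ccontr)
    assume "\<not> ?thesis"
    then have "\<forall>i<r. ?w i \<le> 0" by (meson not_le)
    then have "(\<Sum>i<r. ?w i) \<le> 0" by (intro sum_nonpos) blast
    then show False using sum p by simp
  qed
  then obtain i where i: "i < r" "0 < ?w i" by blast
  have "?w i \<le> p" unfolding sum[symmetric] using i by (intro member_le_sum) auto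
  then have "\<mu> \<le> c" using i(2) c[OF i(1)] by (auto simp: max_def split: if_splits)
  then have M: "psd_mat n M"
    unfolding M_def by (intro psd_mat_add S_psd psd_mat_smult C_psd) auto
  have Mc: "M \<in> carrier_mat n n" using M by (simp add: psd_mat_def hermitian_mat_def)
  have decomp: "S ?w - ?X = complex_of_real \<mu> \<cdot>\<^sub>m 1\<^sub>m n + M"
  proof (rule eq_matI)
    fix a b assume
      "a < dim_row (complex_of_real \<mu> \<cdot>\<^sub>m 1\<^sub>m n + M)"
        "b < dim_col (complex_of_real \<mu> \<cdot>\<^sub>m 1\<^sub>m n + M)"
    then have ab: "a < n" "b < n" using Mc by auto
    \<comment> \<open>Pointwise, \<open>max 0 (\<mu> - t) + t\<close> and
      \<open>max 0 (t - \<mu>) + \<mu>\<close> both equal the maximum of \<open>\<mu>\<close> and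
      \<open>t\<close>.\<close>
    have "S ?w + S (\<lambda>i. 1 / f i) = S ?m + complex_of_real \<mu> \<cdot>\<^sub>m S (\<lambda>_. 1)"
      unfolding S_add S_smult by (intro S_cong) (auto simp: max_def)
    from arg_cong[OF this, of "\<lambda>A. A $$ (a, b)"]
    have "S ?w $$ (a, b) + S (\<lambda>i. 1 / f i) $$ (a, b) = S ?m $$ (a, b) + \<mu> * S (\<lambda>_. 1) $$ (a, b)"
      using ab by simp
    then show "(S ?w - ?X) $$ (a, b) = (complex_of_real \<mu> \<cdot>\<^sub>m 1\<^sub>m n + M) $$ (a, b)"
      using ab by (simp add: M_def C_def algebra_simps)
  qed (simp_all add: M_def)
  have "M * S ?w = S ?m * S ?w + complex_of_real (c - \<mu>) \<cdot>\<^sub>m C * S ?w"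
    unfolding M_def by (rule add_mult_distrib_mat[of _ n n _ _ n]) auto
  \<comment> \<open>At every index one of the two positive parts vanishes (complementary
    slackness).\<close>
  also have "S ?m * S ?w = S (\<lambda>_. 0)"
    unfolding S_mult by (intro S_cong) (auto simp: max_def)
  also have "complex_of_real (c - \<mu>) \<cdot>\<^sub>m C * S ?w = complex_of_real (c - \<mu>) \<cdot>\<^sub>m (C * S ?w)"
    by (rule mult_smult_assoc_mat[of _ n n _ n]) auto
  finally have MW: "M * S ?w = 0\<^sub>m n n" by (simp add: C_S S_zero)
  fix Z assume Z: "Z \<in> strategy_set n p"
  then have Zc: "Z \<in> carrier_mat n n" by (auto simp: strategy_set_def psd_mat_def hermitian_mat_def)
  have ZW: "Z - S ?w \<in> carrier_mat n n" using Zc by (auto simp: minus_carrier_mat)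
  have "(complex_of_real \<mu> \<cdot>\<^sub>m 1\<^sub>m n + M) * (Z - S ?w)
      = complex_of_real \<mu> \<cdot>\<^sub>m 1\<^sub>m n * (Z - S ?w) + M * (Z - S ?w)"
    using Mc ZW by (intro add_mult_distrib_mat[of _ n n _ _ n]) auto
  also have "complex_of_real \<mu> \<cdot>\<^sub>m 1\<^sub>m n * (Z - S ?w) = complex_of_real \<mu> \<cdot>\<^sub>m (Z - S ?w)"
    using ZW by (subst mult_smult_assoc_mat[of _ n n _ n]) auto
  also have "M * (Z - S ?w) = M * Z"
    using Mc Zc by (subst mult_minus_distrib_mat[of _ n n _ n]) (auto simp: MW intro!: eq_matI)
  finally have "mtrace ((S ?w - ?X) * (Z - S ?w))
    = complex_of_real \<mu> * mtrace (Z - S ?w) + mtrace (M * Z)"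
    unfolding decomp using Mc Zc ZW by (simp add: mtrace_add[of _ n] mtrace_smult[of _ n])
  \<comment> \<open>Both matrices have trace \<open>p\<close>, so the multiple of the identity drops
    out.\<close>
  moreover have "mtrace (Z - S ?w) = 0"
    using Z W Zc by (simp add: mtrace_minus[of _ n] strategy_set_def)
  ultimately show "0 \<le> Re (mtrace ((S ?w - ?X) * (Z - S ?w)))"
    using mtrace_psd_mult_nonneg[OF M, of Z] Z by (simp add: strategy_set_def)
qed

end

subsection \<open>Reduced eigendecompositions\<close>

lemma reduced_eigendecomp_iff:
  assumes "A \<in> carrier_mat n n"
  shows "reduced_eigendecomp A r U D \<longleftrightarrow> isometry n r U \<and>
    D \<in> carrier_mat r r \<and> diagonal_mat D \<and> (\<forall>i<r. 0 < D $$ (i, i)) \<and> A = isometry.S r U (\<lambda>i. D $$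
      (i, i))"
proof -
  have D: "map_mat complex_of_real D = mat_diag r (\<lambda>i. complex_of_real (D $$ (i, i)))"
    if "D \<in> carrier_mat r r" "diagonal_mat D"
    using that by (intro eq_matI) (auto simp: mat_diag_def diagonal_mat_def)
  show ?thesis
    using assms by (auto simp: reduced_eigendecomp_def isometry_def D isometry.S_def)
qed

lemma map_mat_wf_levels:
  "D \<in> carrier_mat r r \<Longrightarrow>
    map_mat complex_of_real (wf_levels \<mu> D) = mat_diag r (\<lambda>i. complex_of_real (max 0 (\<mu> - 1 / D $$
      (i, i))))"
  by (intro eq_matI) (auto simp: wf_levels_def mat_diag_def)

lemma mtrace_wf_levels:
  "D \<in> carrier_mat r r \<Longrightarrow> mtrace (wf_levels \<mu> D) = (\<Sum>i<r. max 0 (\<mu> - 1 / D $$ (i, i)))"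
  by (simp add: wf_levels_def mat_diag_def mtrace_def)

text \<open>Intermediate value theorem: the total power is continuous in the level, vanishes at
  level 0, and reaches \<open>p\<close> at level \<open>p + 1 / f 0\<close> through channel 0
  alone.\<close>

lemma wf_level_exists:
  fixes f :: "nat \<Rightarrow> real"
  assumes "0 < r" "\<And>i. i < r \<Longrightarrow> 0 < f i" "0 \<le> p"
  shows "\<exists>\<mu>. (\<Sum>i<r. max 0 (\<mu> - 1 / f i)) = p"
proof -
  let ?g = "\<lambda>\<mu>. \<Sum>i<r. max 0 (\<mu> - 1 / f i)"
  have "?g 0 = 0" using assms(2) by (intro sum.neutral) (auto simp: less_imp_le)
  then have "?g 0 \<le> p" using assms(3) by simp
  moreover have "p \<le> ?g (p + 1 / f 0)"
  proof -
    have "p \<le> max 0 (p + 1 / f 0 - 1 / f 0)" by simp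
    also have "\<dots> \<le> ?g (p + 1 / f 0)" using assms(1) by (intro member_le_sum) auto
    finally show ?thesis .
  qed
  moreover have "0 \<le> p + 1 / f 0" using assms by (simp add: less_imp_le)
  moreover have "continuous_on {0..p + 1 / f 0} ?g" by (intro continuous_intros)
  ultimately show ?thesis using IVT'[of ?g 0 p "p + 1 / f 0"] by blast
qed

subsection \<open>Bounds on quadratic forms\<close>

lemma spectral_radius_nonneg:
  assumes "A \<in> carrier_mat n n" "0 < n"
  shows "0 \<le> spectral_radius A"
  using spectral_radius_mem_max(1)[OF assms] by auto

lemma (in isometry) le_spectral_radius:
  assumes "i < r"
  shows "f i \<le> spectral_radius (S f)"
proof -
  have "0 < n" using assms r_le_n by simp
  moreover have "norm (complex_of_real (f i)) \<in> norm ` spectrum (S f)"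
    using eigenvalue_S[OF assms, of f] unfolding spectrum_def by blast
  ultimately have "norm (complex_of_real (f i)) \<le> spectral_radius (S f)"
    by (intro spectral_radius_mem_max(2)[OF S_carrier])
  then show ?thesis by simp
qed

text \<open>Bessel's inequality passes from the coordinates to all of \<open>v\<close>; this uses
  \<open>0 \<le> s\<close>.\<close>

lemma (in isometry) S_quad_le:
  assumes "v \<in> carrier_vec n" "0 \<le> s" "\<And>i. i < r \<Longrightarrow> f i \<le> s"
  shows "Re ((S f *\<^sub>v v) \<bullet>c v) \<le> s * vnorm2 v"
proof -
  have "Re ((S f *\<^sub>v v) \<bullet>c v) = (\<Sum>i<r. f i * (cmod (coords v $ i))\<^sup>2)"
    using assms by (simp add: S_quad)
  also have "\<dots> \<le> s * (\<Sum>i<r. (cmod (coords v $ i))\<^sup>2)"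
    unfolding sum_distrib_left using assms by (intro sum_mono mult_right_mono) auto
  also have "\<dots> \<le> s * vnorm2 v"
    using assms by (intro mult_left_mono bessel) auto
  finally show ?thesis .
qed

lemma psd_quad_le_spectral_radius:
  assumes "psd_mat n A" "0 < n" "v \<in> carrier_vec n"
  shows "Re ((A *\<^sub>v v) \<bullet>c v) \<le> spectral_radius A * vnorm2 v"
proof -
  obtain r U f where "isometry n r U" "\<And>i. i < r \<Longrightarrow> 0 < f i" and A: "A = isometry.S r U f"
    using psd_reduced_spectral[OF assms(1)] by blast
  interpret isometry n r U by fact
  show ?thesis unfolding A
    using assms le_spectral_radius spectral_radius_nonneg[OF S_carrier] by (intro S_quad_le) auto
qed

text \<open>Every eigenvalue is at most the sum of all of them, since none is negative.\<close>

lemma psd_quad_le_trace: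
  assumes "psd_mat n A" "mtrace A = complex_of_real p" "v \<in> carrier_vec n"
  shows "Re ((A *\<^sub>v v) \<bullet>c v) \<le> p * vnorm2 v"
proof -
  obtain r U f where "isometry n r U" and f: "\<And>i. i < r \<Longrightarrow> 0 < f i" and A: "A = isometry.S r U f"
    using psd_reduced_spectral[OF assms(1)] by blast
  interpret isometry n r U by fact
  have p: "p = (\<Sum>i<r. f i)" using assms(2) unfolding A S_mtrace of_real_eq_iff by simp
  show ?thesis unfolding A p
    using assms(3) f by (intro S_quad_le sum_nonneg member_le_sum) (auto intro: less_imp_le)
qed

text \<open>Eigenvalues in \<open>(0, s]\<close> satisfy \<open>(f i)\<^sup>2 \<le> s * f i\<close>.
  Applied to \<open>R\<close> at the vector \<open>R\<^sup>-\<^sup>1 y\<close>, this is the bound of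
  \<open>R\<^sup>-\<^sup>1\<close> from below by \<open>I / s\<close>.\<close>

lemma psd_vnorm2_le:
  assumes "psd_mat n A" "v \<in> carrier_vec n"
    and le: "\<And>w. w \<in> carrier_vec n \<Longrightarrow> Re ((A *\<^sub>v w) \<bullet>c w) \<le> s * vnorm2 w"
  shows "vnorm2 (A *\<^sub>v v) \<le> s * Re ((A *\<^sub>v v) \<bullet>c v)"
proof -
  obtain r U f where "isometry n r U" and f: "\<And>i. i < r \<Longrightarrow> 0 < f i" and A: "A = isometry.S r U f"
    using psd_reduced_spectral[OF assms(1)] by blast
  interpret isometry n r U by fact
  have fs: "f i \<le> s" if "i < r" for i
    using le[of "col U i"] that by (simp add: A S_col cscalar_prod_self vnorm2_col)
  have "(\<Sum>i<r. (f i)\<^sup>2 * (cmod (coords v $ i))\<^sup>2) \<le> (\<Sum>i<r. s * (f i * (cmod (coords v $ i))\<^sup>2))"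
    using f fs by (intro sum_mono)
      (simp add: power2_eq_square mult.assoc[symmetric] mult_right_mono less_imp_le)
  then show ?thesis using assms(2) by (simp add: A vnorm2_S S_quad sum_distrib_left)
qed

section \<open>Gram matrices and the norm of the adjoint\<close>

lemma gram_hermitian:
  assumes "H \<in> carrier_mat m n"
  shows "hermitian_mat n (mat_adjoint H * H)"
  using assms
    by (auto simp: hermitian_mat_def mat_adjoint_mult[of "mat_adjoint H" n m H n] intro: mult_carrier_mat[of _ n m])

lemma gram_psd:
  assumes "H \<in> carrier_mat m n"
  shows "psd_mat n (mat_adjoint H * H)"
  using vnorm2_mult[OF assms] gram_hermitian[OF assms]
  by (simp add: psd_mat_def) (metis Re_complex_of_real vnorm2_nonneg)

text \<open>The matrices \<open>H\<^sup>H H\<close> and \<open>H H\<^sup>H\<close> have the same operator norm; expanding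
  \<open>0 \<le> |t u - H w|\<^sup>2\<close> for \<open>w = H\<^sup>H u\<close> gives the bound without square roots.\<close>
lemma vnorm2_adjoint_le:
  assumes H: "H \<in> carrier_mat m n" and u: "u \<in> carrier_vec m" and n: "0 < n"
  shows "vnorm2 (mat_adjoint H *\<^sub>v u) \<le> spectral_radius (mat_adjoint H * H) * vnorm2 u"
proof -
  define t where "t = spectral_radius (mat_adjoint H * H)"
  define w where "w = mat_adjoint H *\<^sub>v u"
  have w: "w \<in> carrier_vec n" using H u by (auto simp: w_def intro!: mult_mat_vec_carrier[of _ n m])
  have Hw: "H *\<^sub>v w \<in> carrier_vec m" using H w by (auto intro!: mult_mat_vec_carrier[of _ m n])
  have G: "mat_adjoint H * H \<in> carrier_mat n n" using H by (auto intro: mult_carrier_mat[of _ n m])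
  have t0: "0 \<le> t" unfolding t_def by (rule spectral_radius_nonneg[OF G n])
  have ww: "(H *\<^sub>v w) \<bullet>c u = complex_of_real (vnorm2 w)"
    using adjoint_cscalar_prod[OF H w u] by (simp add: w_def cscalar_prod_self)
  then have ww': "u \<bullet>c (H *\<^sub>v w) = complex_of_real (vnorm2 w)"
    using cscalar_prod_cnj[of "H *\<^sub>v w" u] carrier_vecD[OF Hw] carrier_vecD[OF u] by simp
  have Hw_le: "vnorm2 (H *\<^sub>v w) \<le> t * vnorm2 w"
    using psd_quad_le_spectral_radius[OF gram_psd[OF H] n w] vnorm2_mult[OF H w] unfolding t_def
    by (metis Re_complex_of_real)
  have tu: "complex_of_real t \<cdot>\<^sub>v u \<in> carrier_vec m" using u by simp
  have "complex_of_real (vnorm2 (complex_of_real t \<cdot>\<^sub>v u - H *\<^sub>v w))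
      = complex_of_real (t\<^sup>2 * vnorm2 u - t * vnorm2 w - (t * vnorm2 w - vnorm2 (H *\<^sub>v w)))"
    unfolding vnorm2_diff[OF tu Hw] using u Hw
    by (simp add: conjugate_smult_vec ww ww' cscalar_prod_self power2_eq_square)
  then have "0 \<le> t\<^sup>2 * vnorm2 u - t * vnorm2 w - (t * vnorm2 w - vnorm2 (H *\<^sub>v w))"
    unfolding of_real_eq_iff by (metis vnorm2_nonneg)
  with Hw_le have "t * vnorm2 w \<le> t * (t * vnorm2 u)" by (simp add: power2_eq_square)
  \<comment> \<open>For \<open>t = 0\<close> the factor \<open>t\<close> cannot be cancelled; then
    \<open>H w\<close> vanishes, and with it \<open>vnorm2 w\<close>, the inner product of
    \<open>H w\<close> with \<open>u\<close>.\<close>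
  moreover have "vnorm2 w = 0" if "t = 0"
  proof -
    have "vnorm2 (H *\<^sub>v w) = 0" using Hw_le that vnorm2_nonneg[of "H *\<^sub>v w"] by simp
    then have "H *\<^sub>v w = 0\<^sub>v m" using Hw by (simp add: vnorm2_eq_0)
    then show ?thesis using ww u by simp
  qed
  ultimately show ?thesis using t0 unfolding t_def[symmetric] w_def[symmetric]
    by (cases "t = 0") auto
qed

section \<open>Sums and congruences of semidefinite matrices\<close>

lemma cscalar_prod_mult_sum:
  fixes A :: "complex mat"
  assumes "A \<in> carrier_mat m n" "v \<in> carrier_vec n" "w \<in> carrier_vec m"
  shows "(A *\<^sub>v v) \<bullet>c w = (\<Sum>i<m. \<Sum>k<n. A $$ (i, k) * v $ k * cnj (w $ i))"
  using assms mult_mat_vec_index[OF assms(1,2)]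
  by (simp add: cscalar_prod_sum sum_distrib_right del: index_mult_mat_vec)

lemma psd_mat_sum:
  assumes "finite I" "\<And>r. r \<in> I \<Longrightarrow> psd_mat m (M r)"
  shows "psd_mat m (mat m m (\<lambda>ij. \<Sum>r\<in>I. M r $$ ij))" (is "psd_mat m ?T")
    and "\<And>v. v \<in> carrier_vec m \<Longrightarrow> Re ((mat m m (\<lambda>ij. \<Sum>r\<in>I. M r $$ ij) *\<^sub>v v) \<bullet>c v)
      = (\<Sum>r\<in>I. Re ((M r *\<^sub>v v) \<bullet>c v))"
proof -
  have M: "M r \<in> carrier_mat m m" "mat_adjoint (M r) = M r" if "r \<in> I" for r
    using assms(2)[OF that] by (auto simp: psd_mat_def hermitian_mat_def)
  have cnj: "cnj (M r $$ (j, i)) = M r $$ (i, j)" if "r \<in> I" "i < m" "j < m" for r i j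
    using M[OF that(1)] mat_adjoint_index[of i "M r" j] that by simp
  have herm: "hermitian_mat m ?T"
    unfolding hermitian_mat_def by (auto simp: cnj intro!: eq_matI sum.cong)
  show form: "Re ((?T *\<^sub>v v) \<bullet>c v) = (\<Sum>r\<in>I. Re ((M r *\<^sub>v v) \<bullet>c v))" if v: "v \<in> carrier_vec m" for v
  proof -
    have "(?T *\<^sub>v v) \<bullet>c v = (\<Sum>i<m. \<Sum>k<m. \<Sum>r\<in>I. M r $$ (i, k) * v $ k * cnj (v $ i))"
      using v by (subst cscalar_prod_mult_sum[of _ m m]) (auto simp: sum_distrib_right)
    also have "\<dots> = (\<Sum>i<m. \<Sum>r\<in>I. \<Sum>k<m. M r $$ (i, k) * v $ k * cnj (v $ i))"
      by (intro sum.cong refl sum.swap)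
    also have "\<dots> = (\<Sum>r\<in>I. \<Sum>i<m. \<Sum>k<m. M r $$ (i, k) * v $ k * cnj (v $ i))"
      by (rule sum.swap)
    also have "\<dots> = (\<Sum>r\<in>I. (M r *\<^sub>v v) \<bullet>c v)"
      using v by (intro sum.cong refl) (simp add: cscalar_prod_mult_sum[OF M(1)])
    finally show ?thesis by simp
  qed
  show "psd_mat m ?T"
    unfolding psd_mat_def using herm form assms(2) by (auto simp: psd_mat_def intro!: sum_nonneg)
qed

lemma congruence_form:
  fixes H :: "complex mat"
  assumes "H \<in> carrier_mat m n" "Z \<in> carrier_mat n n" "v \<in> carrier_vec m"
  shows "((H * Z * mat_adjoint H) *\<^sub>v v) \<bullet>c v
    = (Z *\<^sub>v (mat_adjoint H *\<^sub>v v)) \<bullet>c (mat_adjoint H *\<^sub>v v)"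
proof -
  let ?w = "mat_adjoint H *\<^sub>v v"
  have "?w \<in> carrier_vec n" using assms by (auto intro!: mult_mat_vec_carrier[of _ n m])
  then have w: "?w \<in> carrier_vec n" "Z *\<^sub>v ?w \<in> carrier_vec n" "H * Z \<in> carrier_mat m n"
    using assms by (auto intro!: mult_mat_vec_carrier[of _ n n])
  have "(H * Z * mat_adjoint H) *\<^sub>v v = H * Z *\<^sub>v ?w"
    using assms w by (intro assoc_mult_mat_vec[of _ m n _ m]) auto
  also have "\<dots> = H *\<^sub>v (Z *\<^sub>v ?w)"
    using assms w by (intro assoc_mult_mat_vec[of _ m n _ n]) auto
  finally show ?thesis using adjoint_cscalar_prod[OF assms(1) w(2) assms(3)] by simp
qed

lemma congruence_psd:
  assumes H: "H \<in> carrier_mat m n" and Z: "psd_mat n Z"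
  shows "psd_mat m (H * Z * mat_adjoint H)"
proof -
  have c: "Z \<in> carrier_mat n n" "mat_adjoint Z = Z" "H * Z \<in> carrier_mat m n"
    using assms by (auto simp: psd_mat_def hermitian_mat_def)
  have "mat_adjoint (H * Z * mat_adjoint H) = H * (Z * mat_adjoint H)"
    using H c by
      (simp add: mat_adjoint_mult[of "H * Z" m n "mat_adjoint H" m] mat_adjoint_mult[of H m n Z n])
  also have "\<dots> = H * Z * mat_adjoint H"
    using H c by (intro assoc_mult_mat[symmetric, of _ m n _ n _ m]) auto
  finally have "hermitian_mat m (H * Z * mat_adjoint H)"
    using H c by (auto simp: hermitian_mat_def intro!: mult_carrier_mat[of _ m n])
  moreover have "0 \<le> Re (((H * Z * mat_adjoint H) *\<^sub>v v) \<bullet>c v)" if "v \<in> carrier_vec m" for v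
    unfolding congruence_form[OF H c(1) that]
    using Z H that by (auto simp: psd_mat_def intro!: mult_mat_vec_carrier[of _ n m])
  ultimately show ?thesis by (simp add: psd_mat_def)
qed

subsection \<open>Whitened Gram matrices\<close>

lemma pd_imp_psd: "pd_mat n R \<Longrightarrow> psd_mat n R"
proof -
  assume R: "pd_mat n R"
  then have Rc: "R \<in> carrier_mat n n" by (simp add: pd_mat_def hermitian_mat_def)
  have "0 \<le> Re ((R *\<^sub>v v) \<bullet>c v)" if "v \<in> carrier_vec n" for v
    using that R mult_mat_vec_carrier[OF Rc that]
    by (cases "v = 0\<^sub>v n") (auto simp: pd_mat_def less_imp_le)
  then show "psd_mat n R" using R by (simp add: psd_mat_def pd_mat_def)
qed

text \<open>A kernel vector would make the form vanish, so \<open>mat_inverse\<close> succeeds and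
  \<open>minv R\<close> is a true inverse. Its adjoint is a left inverse of the Hermitian
  \<open>R\<close> and therefore coincides with it.\<close>

lemma pd_minv:
  assumes "pd_mat n R"
  shows "minv R \<in> carrier_mat n n" "R * minv R = 1\<^sub>m n" "hermitian_mat n (minv R)"
proof -
  have R: "R \<in> carrier_mat n n" "mat_adjoint R = R" using assms
    by (auto simp: pd_mat_def hermitian_mat_def)
  have "det R \<noteq> 0"
  proof
    assume "det R = 0"
    then obtain v where v: "v \<in> carrier_vec n" "v \<noteq> 0\<^sub>v n" "R *\<^sub>v v = 0\<^sub>v n"
      using det_0_iff_vec_prod_zero_field[OF R(1)] by blast
    then have "Re ((R *\<^sub>v v) \<bullet>c v) = 0" by simp
    then show False using assms v by (auto simp: pd_mat_def)
  qed
  then have "R \<in> Units (ring_mat TYPE(complex) n ())" by (rule det_non_zero_imp_unit[OF R(1)])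
  then obtain B where B: "mat_inverse R = Some B" using mat_inverse(1)[OF R(1), where b = "()"]
    by (cases "mat_inverse R") auto
  from mat_inverse(2)[OF R(1) B] have inv: "R * B = 1\<^sub>m n" "B * R = 1\<^sub>m n" "B \<in> carrier_mat n n"
    by auto
  have minv: "minv R = B" by (simp add: minv_def B)
  have "mat_adjoint B * R = 1\<^sub>m n"
    using arg_cong[OF inv(1), of mat_adjoint] R inv(3) by (simp add: mat_adjoint_mult[of R n n B n])
  then have "mat_adjoint B = mat_adjoint B * (R * B)" using inv by simp
  also have "\<dots> = mat_adjoint B * R * B" using R inv
    by (intro assoc_mult_mat[symmetric, of _ n n _ n _ n]) auto
  also have "\<dots> = B" using \<open>mat_adjoint B * R = 1\<^sub>m n\<close> inv by simp
  finally show "minv R \<in> carrier_mat n n" "R * minv R = 1\<^sub>m n" "hermitian_mat n (minv R)"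
    using inv by (auto simp: minv hermitian_mat_def)
qed

text \<open>With \<open>x = R\<^sup>-\<^sup>1 H v\<close> one has \<open>H v = R x\<close>, and the
  form of \<open>A\<close> at \<open>v\<close> is the form of \<open>R\<close> at \<open>x\<close>.
  All three claims become claims about \<open>R\<close>, without a square root of it.\<close>

lemma whitened_gram:
  assumes R: "pd_mat m R" and H: "H \<in> carrier_mat m n"
  defines "A \<equiv> mat_adjoint H * minv R * H"
  shows "psd_mat n A"
    and "\<And>v. v \<in> carrier_vec n \<Longrightarrow> A *\<^sub>v v = 0\<^sub>v n \<longleftrightarrow> H *\<^sub>v v = 0\<^sub>v m"
    and "\<And>v s. v \<in> carrier_vec n \<Longrightarrow> (\<And>w. w \<in> carrier_vec m \<Longrightarrow> Re ((R *\<^sub>v w) \<bullet>c w) \<le> s * vnorm2 w) \<Longrightarrow>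
           vnorm2 (H *\<^sub>v v) \<le> s * Re ((A *\<^sub>v v) \<bullet>c v)"
proof -
  note B = pd_minv[OF R]
  have Rc: "R \<in> carrier_mat m m" "mat_adjoint R = R" using R
    by (auto simp: pd_mat_def hermitian_mat_def)
  have Bh: "mat_adjoint (minv R) = minv R" using B(3) by (simp add: hermitian_mat_def)
  have HB: "mat_adjoint H * minv R \<in> carrier_mat n m" using H B(1)
    by (auto intro!: mult_carrier_mat[of _ n m])
  have Ac: "A \<in> carrier_mat n n" unfolding A_def using HB H by (rule mult_carrier_mat)
  have "mat_adjoint A = mat_adjoint H * (minv R * H)"
    unfolding A_def using H B HB Bh
    by (simp add: mat_adjoint_mult[of _ n m H n] mat_adjoint_mult[of "mat_adjoint H" n m "minv R" m])
  also have "\<dots> = A" unfolding A_def using H B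
    by (intro assoc_mult_mat[symmetric, of _ n m _ m _ n]) auto
  finally have herm: "hermitian_mat n A" using Ac by (simp add: hermitian_mat_def)
  define x where "x v = minv R *\<^sub>v (H *\<^sub>v v)" for v
  have x: "x v \<in> carrier_vec m" "R *\<^sub>v x v = H *\<^sub>v v" and Av: "A *\<^sub>v v = mat_adjoint H *\<^sub>v x v"
    and form: "Re ((A *\<^sub>v v) \<bullet>c v) = Re ((R *\<^sub>v x v) \<bullet>c x v)" if v: "v \<in> carrier_vec n" for v
  proof -
    have Hv: "H *\<^sub>v v \<in> carrier_vec m" using H v by (rule mult_mat_vec_carrier)
    show x: "x v \<in> carrier_vec m" unfolding x_def using B(1) Hv by (rule mult_mat_vec_carrier)
    have "R *\<^sub>v x v = (R * minv R) *\<^sub>v (H *\<^sub>v v)"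
      unfolding x_def using Rc B Hv by (intro assoc_mult_mat_vec[symmetric, of _ m m _ m]) auto
    then show Rx: "R *\<^sub>v x v = H *\<^sub>v v" using Hv B by simp
    have "A *\<^sub>v v = (mat_adjoint H * minv R) *\<^sub>v (H *\<^sub>v v)"
      unfolding A_def using HB H v by (intro assoc_mult_mat_vec[of _ n m _ n]) auto
    also have "\<dots> = mat_adjoint H *\<^sub>v x v"
      unfolding x_def using H B Hv by (intro assoc_mult_mat_vec[of _ n m _ m]) auto
    finally show Av: "A *\<^sub>v v = mat_adjoint H *\<^sub>v x v" .
    have "(A *\<^sub>v v) \<bullet>c v = x v \<bullet>c (H *\<^sub>v v)"
      unfolding Av using adjoint_cscalar_prod[of "mat_adjoint H" n m "x v" v] H v x by simp
    also have "\<dots> = cnj ((R *\<^sub>v x v) \<bullet>c x v)"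
      unfolding Rx
        by (subst cscalar_prod_cnj) (simp_all only: carrier_vecD[OF Hv] carrier_vecD[OF x])
    finally show "Re ((A *\<^sub>v v) \<bullet>c v) = Re ((R *\<^sub>v x v) \<bullet>c x v)" by simp
  qed
  have "psd_mat m R" by (rule pd_imp_psd[OF R])
  then show "psd_mat n A" using herm x(1) by (auto simp: psd_mat_def form)
  show "A *\<^sub>v v = 0\<^sub>v n \<longleftrightarrow> H *\<^sub>v v = 0\<^sub>v m" if v: "v \<in> carrier_vec n" for v
  proof
    assume "A *\<^sub>v v = 0\<^sub>v n"
    then have "Re ((R *\<^sub>v x v) \<bullet>c x v) = 0" using form[OF v] v by simp
    then have "x v = 0\<^sub>v m" using R x(1)[OF v] by (auto simp: pd_mat_def)
    moreover have "R *\<^sub>v 0\<^sub>v m = 0\<^sub>v m" using Rc by (auto intro!: eq_vecI)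
    ultimately show "H *\<^sub>v v = 0\<^sub>v m" using x(2)[OF v] by simp
  next
    assume "H *\<^sub>v v = 0\<^sub>v m"
    then have "x v = 0\<^sub>v m" using B(1) by (auto simp: x_def)
    then show "A *\<^sub>v v = 0\<^sub>v n" using Av[OF v] H by auto
  qed
  show "vnorm2 (H *\<^sub>v v) \<le> s * Re ((A *\<^sub>v v) \<bullet>c v)"
    if v: "v \<in> carrier_vec n" and "\<And>w. w \<in> carrier_vec m \<Longrightarrow> Re ((R *\<^sub>v w) \<bullet>c w) \<le> s * vnorm2 w"
      for v s
    using psd_vnorm2_le[OF \<open>psd_mat m R\<close> x(1)[OF v], of s] that by (simp add: x(2)[OF v] form)
qed

text \<open>The positive eigenvalues are exactly the values of \<open>g\<close>, so the minimum
  ranges over a finite nonempty set.\<close>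

lemma min_pos_eigenvalue_le:
  assumes "isometry n r U" "\<And>i. i < r \<Longrightarrow> 0 < g i" "i < r"
  shows "min_pos_eigenvalue (isometry.S r U g) \<le> g i" "0 < min_pos_eigenvalue (isometry.S r U g)"
proof -
  interpret isometry n r U by fact
  have "{x. 0 < x \<and> eigenvalue (S g) (complex_of_real x)} = g ` {..<r}"
    using eigenvalue_S[of _ g] eigenvalue_SD[of g] assms(2) by fastforce
  then have min: "min_pos_eigenvalue (S g) = Min (g ` {..<r})" by (simp add: min_pos_eigenvalue_def)
  show "min_pos_eigenvalue (S g) \<le> g i" unfolding min using assms(3) by (intro Min_le) auto
  have "Min (g ` {..<r}) \<in> g ` {..<r}" using assms(3) by (intro Min_in) auto
  then show "0 < min_pos_eigenvalue (S g)" unfolding min using assms(2) by auto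
qed

text \<open>An eigenvector of \<open>S f\<close> is orthogonal to the kernel of \<open>H\<close>, where \<open>H\<^sup>H H\<close> is
  bounded below by its least positive eigenvalue.\<close>
lemma (in isometry) min_pos_eigenvalue_gram_le:
  assumes H: "H \<in> carrier_mat m n"
    and ker: "\<And>v. v \<in> carrier_vec n \<Longrightarrow> H *\<^sub>v v = 0\<^sub>v m \<longleftrightarrow> coords v = 0\<^sub>v r" and i: "i < r"
  shows "min_pos_eigenvalue (mat_adjoint H * H) \<le> vnorm2 (H *\<^sub>v col U i)"
    and "0 < min_pos_eigenvalue (mat_adjoint H * H)"
proof -
  let ?G = "mat_adjoint H * H"
  have G: "?G \<in> carrier_mat n n" using H by (auto intro: mult_carrier_mat[of _ n m])
  obtain k V g where V: "isometry n k V" and g: "\<And>i. i < k \<Longrightarrow> 0 < g i"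
    and GV: "?G = isometry.S k V g"
    using psd_reduced_spectral[OF gram_psd[OF H]] by blast
  interpret V: isometry n k V by fact
  define u where "u = col U i"
  \<comment> \<open>The component of \<open>u\<close> in the kernel of \<open>?G\<close>, hence in
    that of \<open>H\<close>. As \<open>u\<close> is orthogonal to the latter, \<open>z\<close>
    vanishes and \<open>u\<close> lies in the span of the columns of \<open>V\<close>.\<close>
  define z where "z = V.C *\<^sub>v u"
  have u: "u \<in> carrier_vec n" "vnorm2 u = 1" using i by (simp_all add: u_def vnorm2_col)
  have z: "z \<in> carrier_vec n" using u by (simp add: z_def)
  have "V.S g *\<^sub>v z = (V.S g * V.C) *\<^sub>v u"
    unfolding z_def using u by (intro assoc_mult_mat_vec[symmetric, of _ n n _ n]) auto
  then have "?G *\<^sub>v z = 0\<^sub>v n" using u by (auto simp: GV V.S_C intro!: eq_vecI)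
  then have "vnorm2 (H *\<^sub>v z) = 0" using vnorm2_mult[OF H z] z by simp
  then have "H *\<^sub>v z = 0\<^sub>v m" using H z vnorm2_eq_0[of "H *\<^sub>v z" m]
    by (auto intro: mult_mat_vec_carrier)
  then have "coords z = 0\<^sub>v r" using ker z by simp
  then have "z \<bullet>c u = 0" using coords_index[OF z i] i by (simp add: u_def)
  then have "vnorm2 z = 0" using V.C_quad[OF u(1)] by (simp add: z_def)
  then have one: "(\<Sum>j<k. (cmod (V.coords u $ j))\<^sup>2) = 1" using V.vnorm2_split[OF u(1)] u(2)
    by (simp add: z_def)
  then have "0 < k" by (cases k) auto
  have le: "min_pos_eigenvalue ?G \<le> g j" if "j < k" for j
    unfolding GV using min_pos_eigenvalue_le(1)[OF V g that] .
  show "0 < min_pos_eigenvalue ?G"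
    unfolding GV using min_pos_eigenvalue_le(2)[OF V g \<open>0 < k\<close>] .
  have "min_pos_eigenvalue ?G * (\<Sum>j<k. (cmod (V.coords u $ j))\<^sup>2)
    \<le> (\<Sum>j<k. g j * (cmod (V.coords u $ j))\<^sup>2)"
    unfolding sum_distrib_left using le by (intro sum_mono mult_right_mono) auto
  also have "complex_of_real \<dots> = complex_of_real (vnorm2 (H *\<^sub>v u))"
    using vnorm2_mult[OF H u(1)] V.S_quad[OF u(1), of g] by (simp add: GV)
  then have "(\<Sum>j<k. g j * (cmod (V.coords u $ j))\<^sup>2) = vnorm2 (H *\<^sub>v u)"
    by (simp only: of_real_eq_iff)
  finally show "min_pos_eigenvalue ?G \<le> vnorm2 (H *\<^sub>v col U i)"
    by (simp add: one[unfolded u_def] u_def)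
qed

subsection \<open>The interference covariance\<close>

text \<open>Each interferer adds at most its power, which bounds the form of \<open>Qs r\<close> via
  the trace, times the squared operator norm of its channel. Keeping \<open>card I\<close> instead
  of \<open>Q\<close> leaves room for the strict inequality of the theorem.\<close>

lemma intf_cov_bounds:
  fixes Q q :: nat and nT :: "nat \<Rightarrow> nat"
  defines "I \<equiv> {1..Q} - {q}"
  assumes H: "\<And>r. r \<in> I \<Longrightarrow> H r q \<in> carrier_mat m (nT r)"
    and Rn: "pd_mat m (Rn q)" and m: "0 < m" and nT: "\<And>r. r \<in> I \<Longrightarrow> 0 < nT r"
    and Qs: "\<And>r. r \<in> I \<Longrightarrow> Qs r \<in> strategy_set (nT r) (P r)"
    and P: "\<And>r. r \<in> I \<Longrightarrow> 0 \<le> P r \<and> P r \<le> Pm"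
    and K: "\<And>r. r \<in> I \<Longrightarrow> spectral_radius (mat_adjoint (H r q) * H r q) \<le> K"
  shows "pd_mat m (intf_cov Q H Rn q Qs)"
    and "\<And>v. v \<in> carrier_vec m \<Longrightarrow> Re ((intf_cov Q H Rn q Qs *\<^sub>v v) \<bullet>c v)
      \<le> (spectral_radius (Rn q) + real (card I) * (Pm * K)) * vnorm2 v"
proof -
  have Rc: "Rn q \<in> carrier_mat m m" "mat_adjoint (Rn q) = Rn q" using Rn
    by (auto simp: pd_mat_def hermitian_mat_def)
  let ?M = "\<lambda>r. H r q * Qs r * mat_adjoint (H r q)"
  let ?T = "mat m m (\<lambda>ij. \<Sum>r\<in>I. ?M r $$ ij)"
  have R: "intf_cov Q H Rn q Qs = Rn q + ?T" using Rc by (simp add: intf_cov_def I_def)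
  have fin: "finite I" by (simp add: I_def)
  have Qp: "psd_mat (nT r) (Qs r)" "mtrace (Qs r) = complex_of_real (P r)" if "r \<in> I" for r
    using Qs[OF that] by (auto simp: strategy_set_def)
  have M: "psd_mat m (?M r)" if "r \<in> I" for r using congruence_psd[OF H Qp(1)] that by blast
  have T: "psd_mat m ?T" by (rule psd_mat_sum(1)[OF fin M])
  have Tform: "Re ((?T *\<^sub>v v) \<bullet>c v) = (\<Sum>r\<in>I. Re ((?M r *\<^sub>v v) \<bullet>c v))" if "v \<in> carrier_vec m" for v
    by (rule psd_mat_sum(2)[OF fin M that])
  have Tc: "?T \<in> carrier_mat m m" "mat_adjoint ?T = ?T" using T
    by (auto simp: psd_mat_def hermitian_mat_def)
  have form: "Re (((Rn q + ?T) *\<^sub>v v) \<bullet>c v) = Re ((Rn q *\<^sub>v v) \<bullet>c v) + Re ((?T *\<^sub>v v) \<bullet>c v)"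
    if v: "v \<in> carrier_vec m" for v
  proof -
    have "(Rn q + ?T) *\<^sub>v v = Rn q *\<^sub>v v + ?T *\<^sub>v v"
      using Rc v by (intro add_mult_distrib_mat_vec[of _ m m]) auto
    moreover have "Rn q *\<^sub>v v \<in> carrier_vec m" "?T *\<^sub>v v \<in> carrier_vec m"
      using mult_mat_vec_carrier[OF Rc(1) v] mult_mat_vec_carrier[OF Tc(1) v] by auto
    ultimately show ?thesis using v by (simp add: add_scalar_prod_distrib[of _ m])
  qed
  have "hermitian_mat m (Rn q + ?T)"
    using Rc Tc by (simp add: hermitian_mat_def mat_adjoint_add[OF Rc(1) Tc(1)])
  moreover have "0 < Re (((Rn q + ?T) *\<^sub>v v) \<bullet>c v)" if "v \<in> carrier_vec m" "v \<noteq> 0\<^sub>v m" for v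
  proof -
    have "0 < Re ((Rn q *\<^sub>v v) \<bullet>c v)" using Rn that by (simp add: pd_mat_def)
    moreover have "0 \<le> Re ((?T *\<^sub>v v) \<bullet>c v)" using T that by (simp add: psd_mat_def)
    ultimately show ?thesis using form[OF that(1)] by linarith
  qed
  ultimately show "pd_mat m (intf_cov Q H Rn q Qs)" unfolding R pd_mat_def by blast
  fix v :: "complex vec" assume v: "v \<in> carrier_vec m"
  have each: "Re ((?M r *\<^sub>v v) \<bullet>c v) \<le> Pm * K * vnorm2 v" if r: "r \<in> I" for r
  proof -
    let ?w = "mat_adjoint (H r q) *\<^sub>v v"
    have Qc: "Qs r \<in> carrier_mat (nT r) (nT r)" using Qp(1)[OF r]
      by (auto simp: psd_mat_def hermitian_mat_def)
    have w: "?w \<in> carrier_vec (nT r)" using H[OF r] v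
      by (auto intro!: mult_mat_vec_carrier[of _ "nT r" m])
    have G: "mat_adjoint (H r q) * H r q \<in> carrier_mat (nT r) (nT r)"
      using H[OF r] by (auto intro: mult_carrier_mat[of _ "nT r" m])
    have K0: "0 \<le> K" using spectral_radius_nonneg[OF G nT[OF r]] K[OF r] by linarith
    have "Re ((?M r *\<^sub>v v) \<bullet>c v) \<le> P r * vnorm2 ?w"
      unfolding congruence_form[OF H[OF r] Qc v] by (rule psd_quad_le_trace[OF Qp[OF r] w])
    also have "vnorm2 ?w \<le> spectral_radius (mat_adjoint (H r q) * H r q) * vnorm2 v"
      by (rule vnorm2_adjoint_le[OF H[OF r] v nT[OF r]])
    also have "\<dots> \<le> K * vnorm2 v" using K[OF r] by (intro mult_right_mono) auto
    also have "P r * (K * vnorm2 v) \<le> Pm * (K * vnorm2 v)" using P[OF r] K0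
      by (intro mult_right_mono) auto
    finally show ?thesis using P[OF r] by (simp add: mult_left_mono mult.assoc)
  qed
  have "Re ((?T *\<^sub>v v) \<bullet>c v) \<le> (\<Sum>r\<in>I. Pm * K * vnorm2 v)"
    unfolding Tform[OF v] by (intro sum_mono each)
  moreover have "Re ((Rn q *\<^sub>v v) \<bullet>c v) \<le> spectral_radius (Rn q) * vnorm2 v"
    by (rule psd_quad_le_spectral_radius[OF pd_imp_psd[OF Rn] m v])
  ultimately show "Re ((intf_cov Q H Rn q Qs *\<^sub>v v) \<bullet>c v)
      \<le> (spectral_radius (Rn q) + real (card I) * (Pm * K)) * vnorm2 v"
    unfolding R form[OF v] by (simp add: algebra_simps)
qed

subsection \<open>Waterfilling as a projection\<close>

lemma (in isometry) S_vec_eq_0_iff: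
  assumes "v \<in> carrier_vec n" "\<And>i. i < r \<Longrightarrow> f i \<noteq> 0"
  shows "S f *\<^sub>v v = 0\<^sub>v n \<longleftrightarrow> coords v = 0\<^sub>v r"
proof -
  have "S f *\<^sub>v v = 0\<^sub>v n \<longleftrightarrow> (\<Sum>i<r. (f i)\<^sup>2 * (cmod (coords v $ i))\<^sup>2) = 0"
    using assms(1) vnorm2_eq_0[of "S f *\<^sub>v v" n] vnorm2_S[of v f] by simp
  also have "\<dots> \<longleftrightarrow> (\<forall>i<r. coords v $ i = 0)"
    using assms(2) by (subst sum_nonneg_eq_0_iff) auto
  also have "\<dots> \<longleftrightarrow> coords v = 0\<^sub>v r"
    by (auto intro!: eq_vecI)
  finally show ?thesis .
qed

text \<open>The right side mentions only \<open>A\<close>; this makes the definite description in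
  \<open>c_min\<close> well defined.\<close>

lemma reduced_eigendecomp_eigenvalues:
  assumes "A \<in> carrier_mat n n" "reduced_eigendecomp A r U D"
  shows "(\<lambda>i. D $$ (i, i)) ` {..<r} = {x. 0 < x \<and> eigenvalue A (complex_of_real x)}"
proof -
  have "isometry n r U" and D: "\<And>i. i < r \<Longrightarrow> 0 < D $$ (i, i)"
    and A: "A = isometry.S r U (\<lambda>i. D $$ (i, i))"
    using assms(2) unfolding reduced_eigendecomp_iff[OF assms(1)] by auto
  interpret isometry n r U by fact
  show ?thesis
    using eigenvalue_S[of _ "\<lambda>i. D $$ (i, i)"] eigenvalue_SD[of "\<lambda>i. D $$ (i, i)"] D unfolding A
      by fastforce
qed

text \<open>The condition on \<open>c\<close> is phrased by eigenvalues of \<open>A\<close>, so it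
  serves every decomposition at once. As the projection does not involve \<open>U\<close> and
  \<open>D\<close>, the waterfilling matrix is unique.\<close>

lemma waterfilling_eq_strategy_proj:
  assumes A: "A \<in> carrier_mat n n" and H: "H \<in> carrier_mat m n"
    and ker: "\<And>v. v \<in> carrier_vec n \<Longrightarrow> A *\<^sub>v v = 0\<^sub>v n \<longleftrightarrow> H *\<^sub>v v = 0\<^sub>v m"
    and W: "is_waterfilling A r p W" and p: "0 < p"
    and c: "\<And>x. 0 < x \<Longrightarrow> eigenvalue A (complex_of_real x) \<Longrightarrow> p + 1 / x \<le> c"
  shows "strategy_proj n p (- (pseudoinverse A + complex_of_real c \<cdot>\<^sub>m null_proj H)) = W"
proof -
  obtain U D \<mu> where dec: "reduced_eigendecomp A r U D" and \<mu>: "mtrace (wf_levels \<mu> D) = p"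
    and WU: "W = U * map_mat complex_of_real (wf_levels \<mu> D) * mat_adjoint U"
    using W by (auto simp: is_waterfilling_def)
  let ?f = "\<lambda>i. D $$ (i, i)"
  have "isometry n r U" and Dc: "D \<in> carrier_mat r r" and D: "\<And>i. i < r \<Longrightarrow> 0 < ?f i"
    and AS: "A = isometry.S r U ?f"
    using dec unfolding reduced_eigendecomp_iff[OF A] by auto
  interpret isometry n r U by fact
  have f0: "?f i \<noteq> 0" if "i < r" for i using D[OF that] by simp
  have "null_proj H = C"
  proof (rule null_proj_eq[OF H])
    fix v :: "complex vec" assume v: "v \<in> carrier_vec n"
    show "H *\<^sub>v v = 0\<^sub>v m \<longleftrightarrow> coords v = 0\<^sub>v r"
      using ker[OF v] S_vec_eq_0_iff[of v ?f, OF v] f0 unfolding AS by simp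
  qed
  moreover have "pseudoinverse A = S (\<lambda>i. 1 / ?f i)"
    unfolding AS by (rule pseudoinverse_S) (rule f0)
  moreover have "W = S (\<lambda>i. max 0 (\<mu> - 1 / ?f i))"
    unfolding WU map_mat_wf_levels[OF Dc] S_def ..
  moreover have "p + 1 / ?f i \<le> c" if "i < r" for i
    using c[of "?f i"] reduced_eigendecomp_eigenvalues[OF A dec] that by blast
  ultimately show ?thesis
    using strategy_proj_waterfilling[OF p, of \<mu> ?f c] \<mu> unfolding mtrace_wf_levels[OF Dc] by simp
qed

lemma waterfilling_exists:
  assumes A: "A \<in> carrier_mat n n" and "reduced_eigendecomp A r U D" "0 < r" "0 < p"
  shows "\<exists>W. is_waterfilling A r p W"
proof -
  have D: "D \<in> carrier_mat r r" "\<And>i. i < r \<Longrightarrow> 0 < D $$ (i, i)"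
    using assms(2) unfolding reduced_eigendecomp_iff[OF A] by auto
  obtain \<mu> where \<mu>: "(\<Sum>i<r. max 0 (\<mu> - 1 / D $$ (i, i))) = p"
    using wf_level_exists[of r "\<lambda>i. D $$ (i, i)" p] assms(3,4) D(2) by auto
  have "mtrace (wf_levels \<mu> D) = p" using mtrace_wf_levels[OF D(1)] \<mu> by simp
  then show ?thesis using assms(2) unfolding is_waterfilling_def by blast
qed

text \<open>The equality of kernels identifies the size delivered by the spectral theorem with the
  rank of \<open>H\<close>.\<close>

lemma psd_reduced_eigendecomp_exists:
  assumes A: "psd_mat n A" and H: "H \<in> carrier_mat m n"
    and ker: "\<And>v. v \<in> carrier_vec n \<Longrightarrow> A *\<^sub>v v = 0\<^sub>v n \<longleftrightarrow> H *\<^sub>v v = 0\<^sub>v m"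
  shows "\<exists>U D. reduced_eigendecomp A (vec_space.rank m H) U D"
proof -
  have Ac: "A \<in> carrier_mat n n" using A by (simp add: psd_mat_def hermitian_mat_def)
  obtain r U f where iso: "isometry n r U" and f: "\<And>i. i < r \<Longrightarrow> 0 < f i"
    and AS: "A = isometry.S r U f"
    using psd_reduced_spectral[OF A] by blast
  interpret isometry n r U by fact
  have f0: "f i \<noteq> 0" if "i < r" for i using f[OF that] by simp
  have "vec_space.rank m H = r"
  proof (rule rank_eq[OF H])
    fix v :: "complex vec" assume v: "v \<in> carrier_vec n"
    show "H *\<^sub>v v = 0\<^sub>v m \<longleftrightarrow> coords v = 0\<^sub>v r"
      using ker[OF v] S_vec_eq_0_iff[of v f, OF v] f0 unfolding AS by simp
  qed
  moreover have "reduced_eigendecomp A r U (mat_diag r f)"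
    unfolding reduced_eigendecomp_iff[OF Ac]
    using iso f by (auto simp: AS mat_diag_def diagonal_mat_def intro!: S_cong)
  ultimately show ?thesis by blast
qed

theorem lemma1:
  fixes Q q :: nat
    and nT nR :: "nat \<Rightarrow> nat"
    and H :: "nat \<Rightarrow> nat \<Rightarrow> complex mat"
    and Rn Qs :: "nat \<Rightarrow> complex mat"
    and P :: "nat \<Rightarrow> real"
  assumes "\<forall>r \<in> {1..Q}. \<forall>s \<in> {1..Q}. H r s \<in> carrier_mat (nR s) (nT r)"
    and "\<forall>s \<in> {1..Q}. H s s \<noteq> 0\<^sub>m (nR s) (nT s)"
    and "\<forall>s \<in> {1..Q}. pd_mat (nR s) (Rn s)"
    and "\<forall>s \<in> {1..Q}. 0 < P s"
    and "q \<in> {1..Q}"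
    and "Qs \<in> (\<Pi>\<^sub>E r \<in> {1..Q} - {q}. strategy_set (nT r) (P r))"
  shows "(\<forall>c \<ge> c_min Q H Rn P q Qs.
            WF Q H Rn P q Qs =
              strategy_proj (nT q) (P q)
                (- (pseudoinverse (eff_gram Q H Rn q Qs)
                    + complex_of_real c \<cdot>\<^sub>m null_proj (H q q)))) \<and>
         (let bound = ereal (P q) +
                ereal (spectral_radius (Rn q) +
                  real Q * Max (P ` {1..Q}) *
                  Max ((\<lambda>r. spectral_radius (mat_adjoint (H r q) * H r q)) ` {1..Q}))
                / ereal (min_pos_eigenvalue (mat_adjoint (H q q) * H q q))
          in ereal (c_min Q H Rn P q Qs) < bound \<and> bound < \<infinity>)"
proof -
  define n where "n = nT q"
  define m where "m = nR q"
  define I where "I = {1..Q} - {q}"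
  define R where "R = intf_cov Q H Rn q Qs"
  define A where "A = eff_gram Q H Rn q Qs"
  define p where "p = P q"
  define Pm where "Pm = Max (P ` {1..Q})"
  define K where "K = Max ((\<lambda>r. spectral_radius (mat_adjoint (H r q) * H r q)) ` {1..Q})"
  define lam where "lam = min_pos_eigenvalue (mat_adjoint (H q q) * H q q)"
  define s where "s = spectral_radius (Rn q) + real (card I) * (Pm * K)"
  have Hq: "H q q \<in> carrier_mat m n" and Hq0: "H q q \<noteq> 0\<^sub>m m n" and Rnq: "pd_mat m (Rn q)"
    and p: "0 < p"
    using assms(1-5) by (auto simp: m_def n_def p_def)
  \<comment> \<open>A matrix without rows or columns equals the zero matrix, so the nonzero direct
    channels force positive dimensions; spectral radii are then maxima of nonempty sets.\<close>
  have pos: "0 < nT r \<and> 0 < nR r" if "r \<in> {1..Q}" for r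
  proof (rule ccontr)
    assume "\<not> ?thesis"
    moreover have "H r r \<in> carrier_mat (nR r) (nT r)" using assms(1) that by blast
    ultimately have "H r r = 0\<^sub>m (nR r) (nT r)" by (intro eq_matI) auto
    then show False using assms(2) that by blast
  qed
  have m: "0 < m" and n: "0 < n" using pos[OF assms(5)] by (auto simp: m_def n_def)
  have Pm: "P r \<le> Pm" if "r \<in> {1..Q}" for r unfolding Pm_def using that by (intro Max_ge) auto
  have K: "spectral_radius (mat_adjoint (H r q) * H r q) \<le> K" if "r \<in> {1..Q}" for r
    unfolding K_def using that by (intro Max_ge) auto
  have intf: "H r q \<in> carrier_mat m (nT r)" "0 < nT r" "Qs r \<in> strategy_set (nT r) (P r)"
    "0 \<le> P r \<and> P r \<le> Pm" "spectral_radius (mat_adjoint (H r q) * H r q) \<le> K"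
    if "r \<in> {1..Q} - {q}" for r
  proof -
    have r: "r \<in> {1..Q}" using that by blast
    show "H r q \<in> carrier_mat m (nT r)" using assms(1,5) r unfolding m_def by blast
    show "Qs r \<in> strategy_set (nT r) (P r)" using assms(6) that by (rule PiE_mem)
    show "0 < nT r" "0 \<le> P r \<and> P r \<le> Pm" "spectral_radius (mat_adjoint (H r q) * H r q) \<le> K"
      using pos[OF r] Pm[OF r] K[OF r] assms(4) r by (auto simp: less_imp_le)
  qed
  have cov: "pd_mat m R"
    unfolding R_def
      by (rule intf_cov_bounds(1)[where nT = nT and P = P and Pm = Pm and K = K]) (fact intf Rnq m)+
  have cov_le: "Re ((R *\<^sub>v v) \<bullet>c v) \<le> s * vnorm2 v" if "v \<in> carrier_vec m" for v
    unfolding R_def s_def I_def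
    by (rule intf_cov_bounds(2)[where nT = nT and P = P and Pm = Pm and K = K])
      (fact intf Rnq m that)+
  have A_eq: "A = mat_adjoint (H q q) * minv R * H q q" by (simp add: A_def R_def eff_gram_def)
  note gram = whitened_gram[OF cov Hq, folded A_eq]
  have Ac: "A \<in> carrier_mat n n" using gram(1) by (simp add: psd_mat_def hermitian_mat_def)
  define k where "k = direct_rank H q"
  have "k = vec_space.rank m (H q q)" using Hq by (simp add: k_def direct_rank_def)
  then obtain U D where dec: "reduced_eigendecomp A k U D"
    using psd_reduced_eigendecomp_exists[OF gram(1) Hq gram(2)] by auto
  let ?f = "\<lambda>i. D $$ (i, i)"
  have "isometry n k U" and f: "\<And>i. i < k \<Longrightarrow> 0 < ?f i" and AS: "A = isometry.S k U ?f"
    using dec unfolding reduced_eigendecomp_iff[OF Ac] by auto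
  interpret isometry n k U by fact
  have f0: "?f i \<noteq> 0" if "i < k" for i using f[OF that] by simp
  have ker: "H q q *\<^sub>v v = 0\<^sub>v m \<longleftrightarrow> coords v = 0\<^sub>v k" if v: "v \<in> carrier_vec n" for v
    using gram(2)[OF v] S_vec_eq_0_iff[of v ?f, OF v] f0 unfolding AS by simp
  \<comment> \<open>With no coordinates at all, \<open>ker\<close> would place every vector in the
    kernel of the nonzero matrix \<open>H q q\<close>.\<close>
  have k: "0 < k"
  proof (rule ccontr)
    assume "\<not> 0 < k"
    then have "coords v = 0\<^sub>v k" for v by (auto intro!: eq_vecI)
    then have "H q q *\<^sub>v v = 0\<^sub>m m n *\<^sub>v v" if "v \<in> carrier_vec n" for v
      using ker[OF that] that by (auto intro!: eq_vecI)
    then have "H q q = 0\<^sub>m m n" using Hq by (intro eq_mat_vecI[of _ m n]) auto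
    with Hq0 show False ..
  qed
  define E where "E = (\<lambda>x. 1 / x) ` {x. 0 < x \<and> eigenvalue A (complex_of_real x)}"
  have E: "E = (\<lambda>i. 1 / D $$ (i, i)) ` {..<k}" if "reduced_eigendecomp A k U D" for U D
    unfolding E_def reduced_eigendecomp_eigenvalues[OF Ac that, symmetric]
      by (simp add: image_image)
  have "c_min Q H Rn P q Qs = p + Max E"
    unfolding c_min_def A_def[symmetric] k_def[symmetric] p_def[symmetric]
    using dec E by (intro the_equality) (metis | auto)+
  note c_min = this
  have finE: "finite E" "E \<noteq> {}" using E[OF dec] k by auto
  have proj: "strategy_proj n p (- (pseudoinverse A + complex_of_real c \<cdot>\<^sub>m null_proj (H q q))) = W"
    if W: "is_waterfilling A k p W" and c: "p + Max E \<le> c" for W c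
  proof (rule waterfilling_eq_strategy_proj[OF Ac Hq gram(2) W p])
    fix x :: real assume "0 < x" "eigenvalue A (complex_of_real x)"
    then have "1 / x \<in> E" by (auto simp: E_def)
    then show "p + 1 / x \<le> c" using c Max_ge[OF finE(1)] by fastforce
  qed
  obtain W where W: "is_waterfilling A k p W" using waterfilling_exists[OF Ac dec k p] by blast
  \<comment> \<open>By \<open>proj\<close> at the smallest admissible constant, all waterfilling
    matrices equal one and the same projection, so the definite description denotes
    \<open>W\<close>.\<close>
  have WF: "WF Q H Rn P q Qs = W"
    unfolding WF_def A_def[symmetric] k_def[symmetric] p_def[symmetric]
    using W proj[OF _ order_refl] by (intro the_equality) auto
  have 1: "\<forall>c \<ge> c_min Q H Rn P q Qs. WF Q H Rn P q Qs =
      strategy_proj n p (- (pseudoinverse A + complex_of_real c \<cdot>\<^sub>m null_proj (H q q)))"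
    unfolding c_min WF using proj[OF W] by simp
  have lam_le: "lam \<le> vnorm2 (H q q *\<^sub>v col U i)" if "i < k" for i
    unfolding lam_def using Hq ker that by (rule min_pos_eigenvalue_gram_le(1))
  have lam: "0 < lam" using min_pos_eigenvalue_gram_le(2)[OF Hq ker k] by (simp add: lam_def)
  \<comment> \<open>Tested at the unit eigenvector \<open>col U i\<close>: \<open>lam\<close> is at
    most the squared norm of its image under \<open>H q q\<close>, which is at most
    \<open>s * ?f i\<close>.\<close>
  have inv: "1 / ?f i \<le> s / lam" if i: "i < k" for i
  proof -
    have "vnorm2 (H q q *\<^sub>v col U i) \<le> s * Re ((A *\<^sub>v col U i) \<bullet>c col U i)"
      using gram(3)[OF _ cov_le] i by simp
    then have "lam \<le> s * ?f i"
      using lam_le[OF i] i by (simp add: AS S_col cscalar_prod_self vnorm2_col)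
    then show ?thesis using f[OF i] lam by (simp add: field_simps)
  qed
  \<comment> \<open>This gives \<open>0 < K\<close>, on which strictness rests.\<close>
  have "lam \<le> spectral_radius (mat_adjoint (H q q) * H q q)"
  proof -
    have u: "col U 0 \<in> carrier_vec n" "vnorm2 (col U 0) = 1" using k by (simp_all add: vnorm2_col)
    have "vnorm2 (H q q *\<^sub>v col U 0) = Re (((mat_adjoint (H q q) * H q q) *\<^sub>v col U 0) \<bullet>c col U 0)"
      using vnorm2_mult[OF Hq u(1)] by (metis Re_complex_of_real)
    then show ?thesis
      using psd_quad_le_spectral_radius[OF gram_psd[OF Hq] n u(1)] lam_le[OF k] u(2) by simp
  qed
  then have "0 < K" using lam K[OF assms(5)] by linarith
  moreover have "0 < Pm" using Pm[OF assms(5)] p by (simp add: p_def)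
  \<comment> \<open>User \<open>q\<close> does not interfere with itself; the spare summand
    \<open>Pm * K\<close> is positive and separates \<open>s\<close> from the claimed
    numerator.\<close>
  moreover have "real Q = real (card I) + 1" using assms(5) by (simp add: I_def)
  ultimately have s: "s < spectral_radius (Rn q) + real Q * Pm * K"
    by (simp add: s_def algebra_simps)
  have "Max E \<le> s / lam" using finE inv E[OF dec] by (subst Max_le_iff) auto
  also have "\<dots> < (spectral_radius (Rn q) + real Q * Pm * K) / lam" using s lam
    by (rule divide_strict_right_mono)
  finally have 2: "p + Max E < p + (spectral_radius (Rn q) + real Q * Pm * K) / lam" by simp
  \<comment> \<open>Since \<open>lam\<close> is positive, the extended quotient is an ordinary real
    one, so the bound is finite.\<close>
  show ?thesis
    using 1 2 lam c_min
    unfolding A_def[symmetric] n_def[symmetric] p_def[symmetric] Pm_def[symmetric] K_def[symmetric] lam_def[symmetric]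
    by (simp add: Let_def)
qed

end
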